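(* Assume $2^{\aleph_1}=\aleph_2$. Let $\kappa>\omega_2$ be a fixed sufficiently large regular cardinal and let $\mathbb{P}$ be the forcing whose conditions are the symmetric systems of models of two types (as defined in the context), ordered by reverse inclusion. Then $\mathbb{P}$ has the $\aleph_3$-chain condition, i.e. every antichain of $\mathbb{P}$ has cardinality $<\aleph_3$.
   Context: For a set $Q$, $\delta_Q:=\sup(Q\cap\omega_2)$, and $Q[\omega_1]:=\{f(\alpha): f\in Q,\ f \text{ a function with } \operatorname{dom}(f)=\omega_1,\ \alpha\in\omega_1\}$. An adequate model is a member $Q$ of $H(\kappa)$ which is either a countable elementary submodel of $H(\kappa)$, or an elementary submodel of $H(\kappa)$ of size $\aleph_1$ with ${}^\omega Q\subseteq Q$. A finite set $\mathcal{N}\subseteq H(\kappa)$ is a symmetric system of models of two types iff: (A) every $Q\in\mathcal{N}$ is adequate; (B) for distinct $Q_0,Q_1\in\mathcal{N}$ with $\delta_{Q_0}=\delta_{Q_1}$ there is an isomorphism $\Psi_{Q_0[\omega_1],Q_1[\omega_1]}$ between the structures $(Q_0[\omega_1],\in,Q_0)$ and $(Q_1[\omega_1],\in,Q_1)$ which is the identity on $Q_0[\omega_1]\cap Q_1[\omega_1]$ (for $Q_0=Q_1$ this map is the identity); (C) for distinct $Q_0,Q_1\in\mathcal{N}$ with $\delta_{Q_0}<\delta_{Q_1}$ there is $Q_1'\in\mathcal{N}$ with $\delta_{Q_1'}=\delta_{Q_1}$ and $Q_0\in Q_1'[\omega_1]$; (D) for every $Q\in\mathcal{N}$ and every countable $M\in\mathcal{N}$,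 if $Q\in M[\omega_1]$ and there is no $Q'\in\mathcal{N}$ with $\delta_Q<\delta_{Q'}<\delta_M$, then $Q\in M$; (E) for every uncountable $N\in\mathcal{N}$ and countable $M\in\mathcal{N}$ with $N\in M$, $N\cap M\in\mathcal{N}$; (F) for all $Q_0,Q_1,Q_1'\in\mathcal{N}$ with $Q_0\in Q_1$ and $\delta_{Q_1}=\delta_{Q_1'}$, $\Psi_{Q_1[\omega_1],Q_1'[\omega_1]}(Q_0)\in\mathcal{N}$. *)

theory Defs
  imports "HOL-Library.Countable_Set"
begin

unbundle cardinal_syntax

section \<open>A universe of well-founded sets\<close>

text \<open>
  Trees with at most \<open>|'k|\<close>-branching nodes, taken modulo extensional equality, are the sets
  of hereditary cardinality at most \<open>|'k|\<close>. If \<open>\<kappa>\<close> is a cardinal on the type \<open>'k\<close>, then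
  \<open>\<kappa> \<le> |'k|\<close>, so this type contains every set whose transitive closure has size less than
  \<open>\<kappa>\<close>.
\<close>

datatype 'k tree = Empty | Node "'k \<Rightarrow> 'k tree"

primrec children :: "'k tree \<Rightarrow> 'k tree set" where
  "children Empty = {}"
| "children (Node f) = range f"

primrec ext_eq :: "'k tree \<Rightarrow> 'k tree \<Rightarrow> bool" where
  "ext_eq Empty t \<longleftrightarrow> children t = {}"
| "ext_eq (Node f) t \<longleftrightarrow>
     (\<forall>i. \<exists>u\<in>children t. ext_eq (f i) u) \<and> (\<forall>u\<in>children t. \<exists>i. ext_eq (f i) u)"

lemma ext_eq_iff:
  "ext_eq s t \<longleftrightarrow>
     (\<forall>a\<in>children s. \<exists>b\<in>children t. ext_eq a b) \<and> (\<forall>b\<in>children t. \<exists>a\<in>children s. ext_eq a b)"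
  by (cases s) auto

lemma tree_children_induct:
  assumes "\<And>t. (\<And>u. u \<in> children t \<Longrightarrow> P u) \<Longrightarrow> P t"
  shows "P t"
  by (induction t) (rule assms, force)+

lemma ext_eq_refl: "ext_eq t t"
proof (induction t rule: tree_children_induct)
  case (1 t)
  then show ?case by (subst ext_eq_iff) blast
qed

lemma ext_eq_sym: "ext_eq s t \<Longrightarrow> ext_eq t s"
proof (induction s arbitrary: t rule: tree_children_induct)
  case (1 s)
  from 1(2) have "(\<forall>a\<in>children s. \<exists>b\<in>children t. ext_eq a b) \<and>
      (\<forall>b\<in>children t. \<exists>a\<in>children s. ext_eq a b)"
    by (subst (asm) ext_eq_iff)
  with 1(1) show ?case by (subst ext_eq_iff) blast
qed

lemma ext_eq_trans: "ext_eq s t \<Longrightarrow> ext_eq t u \<Longrightarrow> ext_eq s u"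
proof (induction s arbitrary: t u rule: tree_children_induct)
  case (1 s)
  from 1(2) have st: "(\<forall>a\<in>children s. \<exists>b\<in>children t. ext_eq a b) \<and>
      (\<forall>b\<in>children t. \<exists>a\<in>children s. ext_eq a b)"
    by (subst (asm) ext_eq_iff)
  from 1(3) have tu: "(\<forall>a\<in>children t. \<exists>b\<in>children u. ext_eq a b) \<and>
      (\<forall>b\<in>children u. \<exists>a\<in>children t. ext_eq a b)"
    by (subst (asm) ext_eq_iff)
  have "\<exists>c\<in>children u. ext_eq a c" if a: "a \<in> children s" for a
  proof -
    from st a obtain b where b: "b \<in> children t" "ext_eq a b" by blast
    with tu obtain c where "c \<in> children u" "ext_eq b c" by blast
    with 1(1)[OF a b(2)] show ?thesis by blast
  qed
  moreover have "\<exists>a\<in>children s. ext_eq a c" if c: "c \<in> children u" for c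
  proof -
    from tu c obtain b where b: "b \<in> children t" "ext_eq b c" by blast
    with st obtain a where a: "a \<in> children s" "ext_eq a b" by blast
    with 1(1)[OF a b(2)] show ?thesis by blast
  qed
  ultimately show ?case by (subst ext_eq_iff) blast
qed

quotient_type 'k hset = "'k tree" / ext_eq
  by (intro equivpI reflpI sympI transpI) (fact ext_eq_refl, fact ext_eq_sym, fact ext_eq_trans)

lift_definition elts :: "'k hset \<Rightarrow> 'k hset set" is children
  by (subst (asm) ext_eq_iff) (auto simp: rel_set_def)

abbreviation mem :: "'k hset \<Rightarrow> 'k hset \<Rightarrow> bool" where
  "mem x y \<equiv> x \<in> elts y"

text \<open>The set with the given elements; junk unless \<open>|A| \<le> |'k|\<close> (see \<open>elts_vset\<close>).\<close>

definition vset :: "'k hset set \<Rightarrow> 'k hset" where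
  "vset A = (THE x. elts x = A)"

lemma elts_inject: "elts x = elts y \<longleftrightarrow> x = y"
proof
  assume eq: "elts x = elts y"
  obtain s t where st: "x = abs_hset s" "y = abs_hset t"
    by (metis Quotient3_abs_rep[OF Quotient3_hset])
  from eq have img: "abs_hset ` children s = abs_hset ` children t"
    by (simp add: st elts.abs_eq)
  have "\<exists>b\<in>children t. ext_eq a b" if "a \<in> children s" for a
  proof -
    from img that have "abs_hset a \<in> abs_hset ` children t" by blast
    then obtain b where "b \<in> children t" "abs_hset a = abs_hset b" by auto
    then show ?thesis by (auto simp: hset.abs_eq_iff)
  qed
  moreover have "\<exists>a\<in>children s. ext_eq a b" if "b \<in> children t" for b
  proof -
    from img that have "abs_hset b \<in> abs_hset ` children s" by blast
    then obtain a where "a \<in> children s" "abs_hset a = abs_hset b" by auto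
    then show ?thesis by (auto simp: hset.abs_eq_iff)
  qed
  ultimately have "ext_eq s t" by (subst ext_eq_iff) blast
  then show "x = y" by (simp add: st hset.abs_eq_iff)
qed simp

lemma elts_vset:
  fixes A :: "'k hset set"
  assumes "|A| \<le>o |UNIV :: 'k set|"
  shows "elts (vset A) = A"
proof -
  have "\<exists>t :: 'k tree. elts (abs_hset t) = A"
  proof (cases "A = {}")
    case True
    then show ?thesis by (intro exI[of _ Empty]) (simp add: elts.abs_eq)
  next
    case False
    from card_of_ordLeq2[OF this, of "UNIV :: 'k set"] assms
    obtain g :: "'k \<Rightarrow> 'k hset" where g: "range g = A"
      by iprover
    have "elts (abs_hset (Node (\<lambda>i. rep_hset (g i)))) = range (\<lambda>i. abs_hset (rep_hset (g i)))"
      unfolding elts.abs_eq by auto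
    also have "\<dots> = A"
      using g by (simp only: Quotient3_abs_rep[OF Quotient3_hset])
    finally have "elts (abs_hset (Node (\<lambda>i. rep_hset (g i)))) = A" .
    then show ?thesis ..
  qed
  then obtain x :: "'k hset" where x: "elts x = A" by blast
  have "vset A = x"
    unfolding vset_def
  proof (rule the_equality)
    show "y = x" if "elts y = A" for y
      using that x elts_inject[of y x] by blast
  qed (fact x)
  with x show ?thesis by (simp only:)
qed

lemma hset_induct:
  assumes "\<And>x. (\<And>y. mem y x \<Longrightarrow> P y) \<Longrightarrow> P x"
  shows "P x"
proof -
  have "P (abs_hset t)" for t
  proof (induction t rule: tree_children_induct)
    case (1 t)
    then show ?case by (intro assms[of "abs_hset t"]) (auto simp: elts.abs_eq)
  qed
  from this[of "rep_hset x"] show ?thesis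
    by (simp only: Quotient3_abs_rep[OF Quotient3_hset])
qed


section \<open>Ordinals, cardinals, functions\<close>

abbreviation "aleph1 \<equiv> cardSuc natLeq"
abbreviation "aleph2 \<equiv> cardSuc aleph1"
abbreviation "aleph3 \<equiv> cardSuc aleph2"

definition transitive :: "'k hset \<Rightarrow> bool" where
  "transitive x \<longleftrightarrow> (\<forall>y\<in>elts x. elts y \<subseteq> elts x)"

definition ordinal :: "'k hset \<Rightarrow> bool" where
  "ordinal x \<longleftrightarrow> transitive x \<and> (\<forall>y\<in>elts x. transitive y)"

text \<open>The initial von Neumann ordinal of cardinality \<open>r\<close>.\<close>

definition initial_ordinal :: "'r rel \<Rightarrow> 'k hset" where
  "initial_ordinal r =
     (THE \<alpha>. ordinal \<alpha> \<and> |elts \<alpha>| =o r \<and> (\<forall>\<beta>\<in>elts \<alpha>. |elts \<beta>| <o r))"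

definition omega :: "'k hset" where "omega = initial_ordinal natLeq"
definition omega1 :: "'k hset" where "omega1 = initial_ordinal aleph1"
definition omega2 :: "'k hset" where "omega2 = initial_ordinal aleph2"

definition vpair :: "'k hset \<Rightarrow> 'k hset \<Rightarrow> 'k hset" where
  "vpair x y = vset {vset {x}, vset {x, y}}"

definition function_on :: "'k hset \<Rightarrow> 'k hset \<Rightarrow> bool" where
  "function_on f d \<longleftrightarrow>
     (\<forall>p\<in>elts f. \<exists>x\<in>elts d. \<exists>y. p = vpair x y) \<and> (\<forall>x\<in>elts d. \<exists>!y. mem (vpair x y) f)"

definition app :: "'k hset \<Rightarrow> 'k hset \<Rightarrow> 'k hset" where
  "app f x = (THE y. mem (vpair x y) f)"

definition H :: "'k rel \<Rightarrow> 'k hset set" where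
  "H \<kappa> = {x. |{y. mem\<^sup>+\<^sup>+ y x}| <o \<kappa>}"


section \<open>Elementary submodels\<close>

datatype fm = Mem nat nat | Eq nat nat | Neg fm | And fm fm | Ex nat fm

primrec sat :: "'k hset set \<Rightarrow> (nat \<Rightarrow> 'k hset) \<Rightarrow> fm \<Rightarrow> bool" where
  "sat M e (Mem i j) \<longleftrightarrow> mem (e i) (e j)"
| "sat M e (Eq i j) \<longleftrightarrow> e i = e j"
| "sat M e (Neg \<phi>) \<longleftrightarrow> \<not> sat M e \<phi>"
| "sat M e (And \<phi> \<psi>) \<longleftrightarrow> sat M e \<phi> \<and> sat M e \<psi>"
| "sat M e (Ex i \<phi>) \<longleftrightarrow> (\<exists>x\<in>M. sat M (e(i := x)) \<phi>)"

definition elementary_submodel :: "'k hset set \<Rightarrow> 'k hset set \<Rightarrow> bool" where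
  "elementary_submodel M N \<longleftrightarrow> M \<noteq> {} \<and> M \<subseteq> N \<and>
     (\<forall>\<phi> e. (\<forall>i. e i \<in> M) \<longrightarrow> (sat M e \<phi> \<longleftrightarrow> sat N e \<phi>))"


section \<open>Symmetric systems of models of two types\<close>

text \<open>The supremum of a set of von Neumann ordinals is its union.\<close>

definition delta :: "'k hset \<Rightarrow> 'k hset" where
  "delta Q = vset (\<Union>\<alpha> \<in> elts Q \<inter> elts omega2. elts \<alpha>)"

definition hull1 :: "'k hset \<Rightarrow> 'k hset set" (\<open>_[\<omega>\<^sub>1]\<close> [1000] 1000) where
  "Q[\<omega>\<^sub>1] = {app f \<alpha> | f \<alpha>. f \<in> elts Q \<and> function_on f omega1 \<and> \<alpha> \<in> elts omega1}"

definition adequate :: "'k rel \<Rightarrow> 'k hset \<Rightarrow> bool" where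
  "adequate \<kappa> Q \<longleftrightarrow> Q \<in> H \<kappa> \<and>
     (countable (elts Q) \<and> elementary_submodel (elts Q) (H \<kappa>) \<or>
      elementary_submodel (elts Q) (H \<kappa>) \<and> |elts Q| =o aleph1 \<and>
        (\<forall>f. function_on f omega \<and> (\<forall>n\<in>elts omega. app f n \<in> elts Q) \<longrightarrow> f \<in> elts Q))"

definition model_iso :: "'k hset \<Rightarrow> 'k hset \<Rightarrow> ('k hset \<Rightarrow> 'k hset) \<Rightarrow> bool" where
  "model_iso Q0 Q1 F \<longleftrightarrow> bij_betw F (Q0[\<omega>\<^sub>1]) (Q1[\<omega>\<^sub>1]) \<and>
     (\<forall>x\<in>Q0[\<omega>\<^sub>1]. \<forall>y\<in>Q0[\<omega>\<^sub>1]. mem x y \<longleftrightarrow> mem (F x) (F y)) \<and>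
     (\<forall>x\<in>Q0[\<omega>\<^sub>1]. x \<in> elts Q0 \<longleftrightarrow> F x \<in> elts Q1) \<and>
     (\<forall>x\<in>Q0[\<omega>\<^sub>1] \<inter> Q1[\<omega>\<^sub>1]. F x = x)"

text \<open>
  For adequate \<open>Q0\<close> and \<open>Q1\<close> the isomorphism is unique on \<open>Q0[\<omega>\<^sub>1]\<close>, both structures being
  well-founded and extensional, so the choice below does not matter there.
\<close>

definition Psi :: "'k hset \<Rightarrow> 'k hset \<Rightarrow> 'k hset \<Rightarrow> 'k hset" where
  "Psi Q0 Q1 = (if Q0 = Q1 then id else (SOME F. model_iso Q0 Q1 F))"

definition symmetric_system :: "'k rel \<Rightarrow> 'k hset set \<Rightarrow> bool" where
  "symmetric_system \<kappa> \<N> \<longleftrightarrow> finite \<N> \<and> \<N> \<subseteq> H \<kappa> \<and>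
     (\<forall>Q\<in>\<N>. adequate \<kappa> Q) \<and>
     (\<forall>Q0\<in>\<N>. \<forall>Q1\<in>\<N>. Q0 \<noteq> Q1 \<and> delta Q0 = delta Q1 \<longrightarrow> (\<exists>F. model_iso Q0 Q1 F)) \<and>
     (\<forall>Q0\<in>\<N>. \<forall>Q1\<in>\<N>. Q0 \<noteq> Q1 \<and> mem (delta Q0) (delta Q1) \<longrightarrow>
              (\<exists>Q1'\<in>\<N>. delta Q1' = delta Q1 \<and> Q0 \<in> Q1'[\<omega>\<^sub>1])) \<and>
     (\<forall>Q\<in>\<N>. \<forall>M\<in>\<N>. countable (elts M) \<and> Q \<in> M[\<omega>\<^sub>1] \<and>
              \<not> (\<exists>Q'\<in>\<N>. mem (delta Q) (delta Q') \<and> mem (delta Q') (delta M)) \<longrightarrow> mem Q M) \<and>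
     (\<forall>N\<in>\<N>. \<forall>M\<in>\<N>. \<not> countable (elts N) \<and> countable (elts M) \<and> mem N M \<longrightarrow>
              vset (elts N \<inter> elts M) \<in> \<N>) \<and>
     (\<forall>Q0\<in>\<N>. \<forall>Q1\<in>\<N>. \<forall>Q1'\<in>\<N>. mem Q0 Q1 \<and> delta Q1 = delta Q1' \<longrightarrow>
              Psi Q1 Q1' Q0 \<in> \<N>)"


section \<open>Forcing notions\<close>

definition compatible :: "'p set \<Rightarrow> ('p \<Rightarrow> 'p \<Rightarrow> bool) \<Rightarrow> 'p \<Rightarrow> 'p \<Rightarrow> bool" where
  "compatible P le p q \<longleftrightarrow> (\<exists>r\<in>P. le r p \<and> le r q)"

definition forcing_antichain :: "'p set \<Rightarrow> ('p \<Rightarrow> 'p \<Rightarrow> bool) \<Rightarrow> 'p set \<Rightarrow> bool" where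
  "forcing_antichain P le A \<longleftrightarrow>
     A \<subseteq> P \<and> (\<forall>p\<in>A. \<forall>q\<in>A. p \<noteq> q \<longrightarrow> \<not> compatible P le p q)"

definition chain_condition :: "'r rel \<Rightarrow> 'p set \<Rightarrow> ('p \<Rightarrow> 'p \<Rightarrow> bool) \<Rightarrow> bool" where
  "chain_condition r P le \<longleftrightarrow> (\<forall>A. forcing_antichain P le A \<longrightarrow> |A| <o r)"

end

theory Submission
  imports Defs "HOL-Library.Countable_Set_Type"
begin

text \<open>
  The union of a condition with all its models and their hulls has size at most \<open>\<aleph>\<^sub>1\<close>. Since
  \<open>2\<^bsup>\<aleph>\<^sub>1\<^esup> = \<aleph>\<^sub>2\<close>, there are at most \<open>\<aleph>\<^sub>2\<close> isomorphism types of such structures, and in any family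
  of more than \<open>\<aleph>\<^sub>2\<close> conditions there are two, \<open>p\<close> and \<open>q\<close>, with an isomorphism \<open>\<Phi>\<close> between their
  structures that is the identity on the intersection and preserves the ordinals \<open>\<delta>\<^sub>Q\<close>. Then
  \<open>p \<union> q\<close> is a condition: an isomorphism from a model of \<open>p\<close> to a model of \<open>q\<close> is obtained by
  composing one inside \<open>p\<close> with \<open>\<Phi>\<close>. For clause (F) this composition has to agree with \<open>\<Psi>\<close> on
  the models \<open>Q\<close> themselves; this follows as each \<open>Q\<close> is well-founded and extensional and is
  contained in \<open>Q[\<omega>\<^sub>1]\<close>, the latter because \<open>\<omega>\<^sub>1\<close> and hence all constant functions on it
  are definable in \<open>H(\<kappa>)\<close>.
\<close>

section \<open>Infinite combinatorics\<close>

text \<open>A nonempty \<open>B\<close> of size at most \<open>r\<close> is the image of a function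
  from \<open>Field r\<close> to \<open>S\<close>, so there are at most \<open>s ^c r\<close> such
  sets. The empty set is counted separately.\<close>

lemma card_of_bounded_subsets:
  assumes r: "Cinfinite r" and s: "Cinfinite s" and exp: "s ^c r \<le>o s" and S: "|S| \<le>o s"
  shows "|{B. B \<subseteq> S \<and> |B| \<le>o r}| \<le>o s"
proof -
  let ?F = "(\<lambda>f. f ` Field r) ` Func (Field r) S"
  have "{B. B \<subseteq> S \<and> |B| \<le>o r} \<subseteq> ?F \<union> {{}}"
  proof
    fix B assume "B \<in> {B. B \<subseteq> S \<and> |B| \<le>o r}"
    then have B: "B \<subseteq> S" "|B| \<le>o r" by auto
    show "B \<in> ?F \<union> {{}}"
    proof (cases "B = {}")
      case False
      have "|B| \<le>o |Field r|"
        using ordLeq_ordIso_trans[OF B(2) ordIso_symmetric[OF card_of_Field_ordIso]] r by simp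
      then obtain g where g: "g ` Field r = B"
        using card_of_ordLeq2[OF False, of "Field r"] by iprover
      let ?f = "\<lambda>i. if i \<in> Field r then g i else undefined"
      have "?f \<in> Func (Field r) S" using g B(1) by (auto simp: Func_def)
      moreover have "?f ` Field r = B" using g by auto
      ultimately show ?thesis by blast
    qed simp
  qed
  moreover have "|?F \<union> {{}}| \<le>o s"
  proof (rule Un_Cinfinite_bound)
    have "|?F| \<le>o |S| ^c r"
      unfolding cexp_def Field_card_of by (rule card_of_image)
    also have "|S| ^c r \<le>o s ^c r"
      using S r by (intro cexp_mono1) auto
    finally show "|?F| \<le>o s" by (rule ordLeq_transitive[OF _ exp])
    show "|{{}}| \<le>o s"
      using s by (intro ordLess_imp_ordLeq finite_ordLess_infinite)
        (auto simp: cinfinite_def Field_card_of card_of_well_order_on card_order_on_well_order_on)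
  qed (fact s)
  ultimately show ?thesis by (rule ordLeq_transitive[OF card_of_mono1])
qed

lemma card_of_Times_Cinfinite_bound:
  assumes "|A| \<le>o s" "|B| \<le>o s" "Cinfinite s"
  shows "|A \<times> B| \<le>o s"
  using assms card_of_Times_ordLeq_infinite_Field by (auto simp: cinfinite_def)

lemma card_of_image_ordLeq: "|A| \<le>o s \<Longrightarrow> |f ` A| \<le>o s"
  by (rule ordLeq_transitive[OF card_of_image])

lemma card_of_subset_ordLeq: "B \<subseteq> A \<Longrightarrow> |A| \<le>o s \<Longrightarrow> |B| \<le>o s"
  by (rule ordLeq_transitive[OF card_of_mono1])

text \<open>
  This plays the role of the \<open>\<Delta>\<close>-system lemma: \<open>\<Gamma> p\<close> is the graph of an enumeration of a small
  set, and two of these sets are found whose enumerations agree on their intersection. The set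
  \<open>A'\<close> below contains, for every small part of a graph over it that some \<open>p \<in> A\<close> realises, a
  witness realising it; any \<open>p \<in> A - A'\<close> then has a suitable partner in \<open>A'\<close>.
\<close>

lemma ex_agreeing_pair:
  fixes \<Gamma> :: "'p \<Rightarrow> ('i \<times> 'x) set" and c :: "'p \<Rightarrow> 'c"
  assumes r: "Cinfinite r" and exp: "cardSuc r ^c r \<le>o cardSuc r"
    and \<Gamma>: "\<And>p. p \<in> A \<Longrightarrow> |\<Gamma> p| \<le>o r" "\<And>p. p \<in> A \<Longrightarrow> fst ` \<Gamma> p \<subseteq> I"
    and I: "|I| \<le>o cardSuc r" and c: "|c ` A| \<le>o cardSuc r"
    and A: "\<not> |A| \<le>o cardSuc r"
  shows "\<exists>p\<in>A. \<exists>q\<in>A. p \<noteq> q \<and> c p = c q \<and> (\<forall>(i, x)\<in>\<Gamma> p. x \<in> snd ` \<Gamma> q \<longrightarrow> (i, x) \<in> \<Gamma> q)"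
proof -
  let ?s = "cardSuc r"
  have s: "Cinfinite ?s" using r by (rule Cinfinite_cardSuc)
  have wo: "Well_order ?s" using s by (simp add: card_order_on_well_order_on)
  have Fs: "|Field ?s| \<le>o ?s" using s by (intro ordIso_imp_ordLeq card_of_Field_ordIso) simp
  \<comment> \<open>A witness realising the colour \<open>d\<close> and the partial graph
    \<open>g\<close>. It is arbitrary if none exists, which is why \<open>step\<close> intersects
    with \<open>A\<close>.\<close>
  define pick where "pick = (\<lambda>(d, g). SOME q. q \<in> A \<and> c q = d \<and> g \<subseteq> \<Gamma> q)"
  define V where "V T = (\<Union>q\<in>T. snd ` \<Gamma> q)" for T
  define step where
    "step T = A \<inter> pick ` (c ` A \<times> {g. g \<subseteq> I \<times> V T \<and> |g| \<le>o r})" for T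
  \<comment> \<open>Recursion along the well-order \<open>?s\<close>: stage \<open>a\<close> adds
    witnesses for all requirements over the values met in \<open>U a\<close>, the union of the
    earlier stages.\<close>
  define T where "T = wfrec (?s - Id) (\<lambda>T a. step (\<Union>b\<in>underS ?s a. T b))"
  define U where "U a = (\<Union>b\<in>underS ?s a. T b)" for a
  define A' where "A' = (\<Union>a\<in>Field ?s. T a)"
  have wf: "wf (?s - Id)" using wo by (simp add: well_order_on_def)
  have T_eq: "T a = step (U a)" for a
  proof -
    have "(\<Union>b\<in>underS ?s a. cut T (?s - Id) a b) = U a"
      by (auto simp: U_def underS_def cut_def)
    then show ?thesis
      using wfrec[OF wf, of "\<lambda>T a. step (\<Union>b\<in>underS ?s a. T b)" a] by (simp add: T_def)
  qed
  have step_A: "step T \<subseteq> A" for T by (auto simp: step_def)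
  have V_card: "|V T| \<le>o ?s" if "|T| \<le>o ?s" "T \<subseteq> A" for T
    unfolding V_def
  proof (intro UNION_Cinfinite_bound ballI that s)
    fix q assume "q \<in> T"
    then have "|\<Gamma> q| \<le>o r" using that \<Gamma> by blast
    then show "|snd ` \<Gamma> q| \<le>o ?s"
      using r by (intro card_of_image_ordLeq ordLeq_transitive[OF _ cardSuc_ordLeq]) auto
  qed
  have step_card: "|step T| \<le>o ?s" if "|T| \<le>o ?s" "T \<subseteq> A" for T
  proof -
    have "|I \<times> V T| \<le>o ?s" using I V_card[OF that] s by (rule card_of_Times_Cinfinite_bound)
    then have "|{g. g \<subseteq> I \<times> V T \<and> |g| \<le>o r}| \<le>o ?s"
      by (rule card_of_bounded_subsets[OF r s exp])
    then have "|c ` A \<times> {g. g \<subseteq> I \<times> V T \<and> |g| \<le>o r}| \<le>o ?s"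
      using c s by (intro card_of_Times_Cinfinite_bound)
    then have "|pick ` (c ` A \<times> {g. g \<subseteq> I \<times> V T \<and> |g| \<le>o r})| \<le>o ?s"
      by (rule card_of_image_ordLeq)
    then show ?thesis unfolding step_def by (rule card_of_subset_ordLeq[rotated]) auto
  qed
  have U_A: "U a \<subseteq> A" for a unfolding U_def using T_eq step_A by blast
  have T_card: "|T a| \<le>o ?s" for a
  proof (induction a rule: wf_induct_rule[OF wf])
    case (1 a)
    have "|U a| \<le>o ?s"
      unfolding U_def
    proof (intro UNION_Cinfinite_bound ballI s)
      show "|underS ?s a| \<le>o ?s"
        using Fs by (rule card_of_subset_ordLeq[rotated]) (auto simp: underS_def Field_def)
    qed (use 1 in \<open>auto simp: underS_def\<close>)
    then show ?case unfolding T_eq using U_A by (rule step_card)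
  qed
  have A'_card: "|A'| \<le>o ?s"
    unfolding A'_def using T_card by (intro UNION_Cinfinite_bound ballI s Fs)
  have U_mono: "U a \<subseteq> U b" if "(a, b) \<in> ?s" for a b
  proof -
    have "underS ?s a \<subseteq> underS ?s b"
      using that wo by (intro underS_incr) (auto simp: order_on_defs)
    then show ?thesis by (auto simp: U_def)
  qed
  have "\<not> A \<subseteq> A'" using A A'_card card_of_subset_ordLeq by blast
  then obtain p where p: "p \<in> A" "p \<notin> A'" by blast
  \<comment> \<open>The part of the graph of \<open>p\<close> whose values occur at some stage. It
    has size at most \<open>r\<close>, and \<open>?s\<close> is regular as a successor cardinal, so
    \<open>g\<close> already lies over a single \<open>U a\<close>.\<close>
  define g where "g = \<Gamma> p \<inter> (I \<times> V A')"
  have g_card: "|g| \<le>o r" using \<Gamma>(1)[OF p(1)] card_of_subset_ordLeq[of g "\<Gamma> p"] by (auto simp: g_def)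
  \<comment> \<open>\<open>?s\<close> has no last element, so each \<open>T a\<close> is absorbed
    into some later \<open>U b\<close>.\<close>
  have A'_U: "A' \<subseteq> (\<Union>a\<in>Field ?s. U a)"
  proof
    fix q assume "q \<in> A'"
    then obtain a where a: "a \<in> Field ?s" "q \<in> T a" by (auto simp: A'_def)
    obtain b where "b \<in> Field ?s" "a \<noteq> b" "(a, b) \<in> ?s"
      using infinite_Card_order_limit[of ?s a] s a(1) by (auto simp: cinfinite_def)
    then show "q \<in> (\<Union>a\<in>Field ?s. U a)" using a(2) by (auto simp: U_def underS_def)
  qed
  have "g \<subseteq> (\<Union>a\<in>Field ?s. I \<times> V (U a))"
  proof
    fix z assume "z \<in> g"
    then obtain q where q: "fst z \<in> I" "q \<in> A'" "snd z \<in> snd ` \<Gamma> q"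
      unfolding g_def V_def Int_iff mem_Times_iff UN_iff by blast
    then obtain a where "a \<in> Field ?s" "q \<in> U a" using A'_U by blast
    with q have "a \<in> Field ?s" "z \<in> I \<times> V (U a)" by (auto simp: V_def mem_Times_iff)
    then show "z \<in> (\<Union>a\<in>Field ?s. I \<times> V (U a))" by blast
  qed
  moreover have "relChain ?s (\<lambda>a. I \<times> V (U a))"
    using U_mono unfolding relChain_def V_def by (meson Sigma_mono UN_mono order_refl)
  ultimately obtain a where a: "a \<in> Field ?s" "g \<subseteq> I \<times> V (U a)"
    using cardSuc_UNION_Cinfinite[OF r _ _ g_card] by blast
  define q where "q = pick (c p, g)"
  \<comment> \<open>\<open>p\<close> itself meets the requirement, hence the choice made by
    \<open>pick\<close> is a genuine witness.\<close>
  have "\<exists>q. q \<in> A \<and> c q = c p \<and> g \<subseteq> \<Gamma> q"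
    using p by (auto simp: g_def)
  from someI_ex[OF this] have q: "q \<in> A" "c q = c p" "g \<subseteq> \<Gamma> q"
    by (auto simp: q_def pick_def)
  have "q \<in> step (U a)" using q(1) p a(2) g_card by (auto simp: step_def q_def)
  then have "q \<in> A'" using a(1) by (auto simp: A'_def T_eq)
  \<comment> \<open>A value shared with \<open>\<Gamma> q\<close> lies in \<open>V A'\<close>, so
    its pair in \<open>\<Gamma> p\<close> belongs to \<open>g\<close>, which
    \<open>\<Gamma> q\<close> contains.\<close>
  moreover have "(i, x) \<in> \<Gamma> q" if "(i, x) \<in> \<Gamma> p" "x \<in> snd ` \<Gamma> q" for i x
  proof -
    have "i \<in> I" using \<Gamma>(2)[OF p(1)] that(1) by force
    moreover have "x \<in> V A'" using that(2) \<open>q \<in> A'\<close> by (auto simp: V_def)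
    ultimately show ?thesis using that(1) q(3) by (auto simp: g_def)
  qed
  ultimately show ?thesis using p q by (intro bexI[of _ p] bexI[of _ q]) auto
qed

section \<open>Ordinals and closure properties of \<open>H(\<kappa>)\<close>\<close>

lemma mem_irrefl: "\<not> mem x x"
  by (induction x rule: hset_induct) blast

lemma ordinal_mem: "ordinal x \<Longrightarrow> mem y x \<Longrightarrow> ordinal y"
  unfolding ordinal_def transitive_def by blast

text \<open>If no alternative holds, the induction hypotheses place each member of \<open>x\<close>
  in \<open>y\<close> and conversely, since their other cases would make \<open>x\<close> and
  \<open>y\<close> comparable by transitivity. Extensionality then gives
  \<open>x = y\<close>.\<close>

lemma ordinal_linear: "ordinal x \<Longrightarrow> ordinal y \<Longrightarrow> mem x y \<or> x = y \<or> mem y x"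
proof (induction x arbitrary: y rule: hset_induct)
  case (1 x)
  note IHx = 1(1) and x = 1(2)
  show ?case using 1(3)
  proof (induction y rule: hset_induct)
    case (1 y)
    note IHy = 1(1) and y = 1(2)
    show ?case
    proof (rule ccontr)
      assume neq: "\<not> ?case"
      have "elts x \<subseteq> elts y"
      proof
        fix a assume a: "mem a x"
        from IHx[OF a ordinal_mem[OF x a] y] show "mem a y"
          using neq a x unfolding ordinal_def transitive_def by blast
      qed
      moreover have "elts y \<subseteq> elts x"
      proof
        fix a assume a: "mem a y"
        from IHy[OF a ordinal_mem[OF y a]] show "mem a x"
          using neq a y unfolding ordinal_def transitive_def by blast
      qed
      ultimately have "x = y" using elts_inject by blast
      then show False using neq by blast
    qed
  qed
qed

text \<open>The Mostowski collapse \<open>c\<close> of the well-order \<open>r\<close> provides the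
  ordinal. The bound \<open>le\<close> keeps \<open>vset\<close> meaningful, and since
  \<open>r\<close> is a cardinal, its proper initial segments are smaller than
  \<open>r\<close>.\<close>

lemma ex_initial_ordinal:
  fixes r :: "'r rel"
  assumes r: "Card_order r" and le: "r \<le>o |UNIV :: 'k set|"
  shows "\<exists>\<alpha> :: 'k hset. ordinal \<alpha> \<and> |elts \<alpha>| =o r \<and> (\<forall>\<beta>\<in>elts \<alpha>. |elts \<beta>| <o r)"
proof -
  define c :: "'r \<Rightarrow> 'k hset" where "c = wfrec (r - Id) (\<lambda>c a. vset (c ` underS r a))"
  have wo: "Well_order r" using r by (simp add: card_order_on_well_order_on)
  have wf: "wf (r - Id)" using wo by (simp add: well_order_on_def)
  have tr: "trans r" and as: "antisym r" and tot: "Total r" using wo by (auto simp: order_on_defs)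
  have Fr: "|Field r| \<le>o |UNIV :: 'k set|"
    by (rule ordIso_ordLeq_trans[OF card_of_Field_ordIso[OF r] le])
  have c_eq: "c a = vset (c ` underS r a)" for a
  proof -
    have "cut c (r - Id) a ` underS r a = c ` underS r a"
      by (intro image_cong) (auto simp: underS_def cut_def)
    then show ?thesis
      using wfrec[OF wf, of "\<lambda>c a. vset (c ` underS r a) :: 'k hset" a] by (simp flip: c_def)
  qed
  have under_sub: "underS r a \<subseteq> Field r" for a by (auto simp: underS_def Field_def)
  have elts_c: "elts (c a) = c ` underS r a" for a
    unfolding c_eq[of a]
    by (intro elts_vset card_of_image_ordLeq card_of_subset_ordLeq[OF under_sub Fr])
  have c_mem: "mem (c b) (c a)" if "(b, a) \<in> r" "b \<noteq> a" for a b
    using that by (auto simp: elts_c underS_def)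
  have inj: "inj_on c (Field r)"
  proof (rule inj_onI, rule ccontr)
    fix a b assume "a \<in> Field r" "b \<in> Field r" "c a = c b" "a \<noteq> b"
    then show False
      using tot c_mem mem_irrefl unfolding total_on_def by metis
  qed
  define \<alpha> where "\<alpha> = vset (c ` Field r)"
  have elts_\<alpha>: "elts \<alpha> = c ` Field r"
    unfolding \<alpha>_def by (intro elts_vset card_of_image_ordLeq Fr)
  have "transitive (c a)" for a
    unfolding transitive_def
  proof
    fix y assume "mem y (c a)"
    then obtain b where b: "y = c b" "b \<in> underS r a" by (auto simp: elts_c)
    have "underS r b \<subseteq> underS r a"
      using b(2) tr as by (intro underS_incr) (auto simp: underS_def)
    then show "elts y \<subseteq> elts (c a)" by (auto simp: b elts_c)
  qed
  then have "ordinal \<alpha>"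
    using under_sub unfolding ordinal_def transitive_def[of \<alpha>] by (auto simp: elts_\<alpha> elts_c)
  moreover have "|elts \<alpha>| =o r"
  proof -
    have "|elts \<alpha>| =o |Field r|"
      using inj unfolding elts_\<alpha>
      by (intro ordIso_symmetric[OF card_of_ordIsoI[OF inj_on_imp_bij_betw]])
    then show ?thesis using card_of_Field_ordIso[OF r] by (rule ordIso_transitive)
  qed
  moreover have "|elts \<beta>| <o r" if \<beta>: "mem \<beta> \<alpha>" for \<beta>
  proof -
    obtain a where "a \<in> Field r" "\<beta> = c a" using \<beta> by (auto simp: elts_\<alpha>)
    then show ?thesis
      using ordLeq_ordLess_trans[OF card_of_image card_of_underS[OF r]] by (simp add: elts_c)
  qed
  ultimately show ?thesis by blast
qed

text \<open>The description by \<open>THE\<close> is proper: of two distinct candidates one would be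
  a member of the other, hence of size less than \<open>r\<close>.\<close>

lemma initial_ordinal:
  fixes r :: "'r rel"
  assumes r: "Card_order r" and le: "r \<le>o |UNIV :: 'k set|"
  defines "\<alpha> \<equiv> initial_ordinal r :: 'k hset"
  shows "ordinal \<alpha>" "|elts \<alpha>| =o r" "mem \<beta> \<alpha> \<Longrightarrow> |elts \<beta>| <o r"
proof -
  let ?P = "\<lambda>\<alpha> :: 'k hset. ordinal \<alpha> \<and> |elts \<alpha>| =o r \<and> (\<forall>\<beta>\<in>elts \<alpha>. |elts \<beta>| <o r)"
  have "\<alpha> = \<beta>" if "?P \<alpha>" "?P \<beta>" for \<alpha> \<beta>
    using ordinal_linear[of \<alpha> \<beta>] that not_ordLess_ordIso by blast
  then have "\<exists>!\<alpha>. ?P \<alpha>" using ex_initial_ordinal[OF r le] by blast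
  from theI'[OF this] show "ordinal \<alpha>" "|elts \<alpha>| =o r" "mem \<beta> \<alpha> \<Longrightarrow> |elts \<beta>| <o r"
    by (auto simp: \<alpha>_def initial_ordinal_def)
qed

lemma Cinfinite_aleph1: "Cinfinite aleph1"
  by (simp add: Cinfinite_cardSuc natLeq_Cinfinite)

lemma Cinfinite_aleph2: "Cinfinite aleph2"
  by (simp add: Cinfinite_cardSuc Cinfinite_aleph1)

lemma aleph1_ordLess_aleph2: "aleph1 <o aleph2"
  using Cinfinite_aleph1 cardSuc_greater by blast

lemma natLeq_ordLess_aleph1: "natLeq <o aleph1"
  using natLeq_Card_order cardSuc_greater by blast

lemma countable_iff_ordLess_aleph1: "countable A \<longleftrightarrow> |A| <o aleph1"
  using cardSuc_ordLeq_ordLess[OF natLeq_Card_order card_of_Card_order, of A]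
  by (simp add: countable_card_le_natLeq)

lemma H_mem: "x \<in> H \<kappa> \<Longrightarrow> mem y x \<Longrightarrow> y \<in> H \<kappa>"
proof -
  assume x: "x \<in> H \<kappa>" and y: "mem y x"
  have "{z. mem\<^sup>+\<^sup>+ z y} \<subseteq> {z. mem\<^sup>+\<^sup>+ z x}" using y by (auto intro: tranclp.trancl_into_trancl)
  then show "y \<in> H \<kappa>"
    using x by (auto simp: H_def intro: ordLeq_ordLess_trans[OF card_of_mono1])
qed

text \<open>Regularity closes \<open>H \<kappa>\<close> under forming sets of fewer than
  \<open>\<kappa>\<close> members; \<open>large\<close> makes the type big enough to contain
  \<open>omega\<close>, \<open>omega1\<close> and \<open>omega2\<close>.\<close>

locale large_regular =
  fixes \<kappa> :: "'k rel"
  assumes Card: "Card_order \<kappa>" and regular: "regularCard \<kappa>" and large: "aleph2 <o \<kappa>"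
begin

lemma Cinfinite_\<kappa>: "Cinfinite \<kappa>"
  using Card cinfinite_mono[OF ordLess_imp_ordLeq[OF large]] Cinfinite_aleph2 by simp

lemma \<kappa>_ordLeq_UNIV: "\<kappa> \<le>o |UNIV :: 'k set|"
  by (rule ordIso_ordLeq_trans[OF ordIso_symmetric[OF card_of_Field_ordIso[OF Card]]])
    (simp add: card_of_mono1)

lemma elts_vset_ordLess: "|A| <o \<kappa> \<Longrightarrow> elts (vset A :: 'k hset) = A"
  by (intro elts_vset ordLeq_transitive[OF ordLess_imp_ordLeq \<kappa>_ordLeq_UNIV])

lemma finite_ordLess_\<kappa>: "finite A \<Longrightarrow> |A| <o \<kappa>"
  using Cinfinite_\<kappa> by (intro finite_ordLess_infinite)
    (auto simp: cinfinite_def Field_card_of card_of_well_order_on card_order_on_well_order_on)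

lemma elts_vset_finite: "finite A \<Longrightarrow> elts (vset A :: 'k hset) = A"
  by (intro elts_vset_ordLess finite_ordLess_\<kappa>)

text \<open>The transitive closure of \<open>vset A\<close> consists of \<open>A\<close> and the
  closures of fewer than \<open>\<kappa>\<close> members, each of size below
  \<open>\<kappa>\<close>; regularity bounds the union.\<close>

lemma vset_in_H:
  assumes A: "A \<subseteq> H \<kappa>" "|A| <o \<kappa>"
  shows "vset A \<in> H \<kappa>"
proof -
  have "{z. mem\<^sup>+\<^sup>+ z (vset A)} \<subseteq> A \<union> (\<Union>y\<in>A. {z. mem\<^sup>+\<^sup>+ z y})"
  proof
    fix z assume "z \<in> {z. mem\<^sup>+\<^sup>+ z (vset A)}"
    then have "mem\<^sup>+\<^sup>+ z (vset A)" by simp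
    then show "z \<in> A \<union> (\<Union>y\<in>A. {z. mem\<^sup>+\<^sup>+ z y})"
      by (cases rule: tranclp.cases) (auto simp: elts_vset_ordLess[OF A(2)])
  qed
  moreover have "|A \<union> (\<Union>y\<in>A. {z. mem\<^sup>+\<^sup>+ z y})| <o \<kappa>"
    using A by (intro Un_Cinfinite_bound_strict regularCard_UNION_bound Cinfinite_\<kappa> regular)
      (auto simp: H_def)
  ultimately show ?thesis
    unfolding H_def by (auto intro: ordLeq_ordLess_trans[OF card_of_mono1])
qed

lemma vpair_in_H: "x \<in> H \<kappa> \<Longrightarrow> y \<in> H \<kappa> \<Longrightarrow> vpair x y \<in> H \<kappa>"
  unfolding vpair_def by (intro vset_in_H finite_ordLess_\<kappa>) (auto intro!: vset_in_H finite_ordLess_\<kappa>)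

lemma vpair_inject: "vpair x y = vpair x' (y' :: 'k hset) \<longleftrightarrow> x = x' \<and> y = y'"
proof
  have inj: "A = B" if "vset A = (vset B :: 'k hset)" "finite A" "finite B" for A B
    using that elts_vset_finite by metis
  assume eq: "vpair x y = vpair x' y'"
  then have "{vset {x}, vset {x, y}} = {vset {x'}, vset {x', y'}}"
    unfolding vpair_def by (rule inj) auto
  then show "x = x' \<and> y = y'"
    by (auto simp: doubleton_eq_iff dest!: inj)
qed simp

lemma aleph1_ordLess_\<kappa>: "aleph1 <o \<kappa>"
  using aleph1_ordLess_aleph2 large by (rule ordLess_transitive)

lemma aleph_ordLeq_UNIV:
  "natLeq \<le>o |UNIV :: 'k set|" "aleph1 \<le>o |UNIV :: 'k set|" "aleph2 \<le>o |UNIV :: 'k set|"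
  by (rule ordLeq_transitive[OF ordLess_imp_ordLeq \<kappa>_ordLeq_UNIV],
      rule ordLess_transitive[OF natLeq_ordLess_aleph1 aleph1_ordLess_\<kappa>])
    (rule ordLeq_transitive[OF ordLess_imp_ordLeq \<kappa>_ordLeq_UNIV],
      fact aleph1_ordLess_\<kappa> large)+

lemmas omega = initial_ordinal[OF natLeq_Card_order aleph_ordLeq_UNIV(1), folded omega_def]
lemmas omega1 = initial_ordinal[OF conjunct2[OF Cinfinite_aleph1] aleph_ordLeq_UNIV(2), folded omega1_def]
lemmas omega2 = initial_ordinal[OF conjunct2[OF Cinfinite_aleph2] aleph_ordLeq_UNIV(3), folded omega2_def]

lemma ordinal_in_H:
  assumes "ordinal x" "|elts x| <o \<kappa>"
  shows "x \<in> H \<kappa>"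
proof -
  have "mem z x" if "mem\<^sup>+\<^sup>+ z x" for z
    using that
  proof (induction rule: converse_tranclp_induct)
    case (step y z)
    then show ?case using assms(1) by (auto simp: ordinal_def transitive_def)
  qed
  then have "{z. mem\<^sup>+\<^sup>+ z x} \<subseteq> elts x" by blast
  then show ?thesis
    unfolding H_def using assms(2) by (auto intro: ordLeq_ordLess_trans[OF card_of_mono1])
qed

lemma omega1_in_H: "omega1 \<in> H \<kappa>"
  by (rule ordinal_in_H[OF omega1(1) ordIso_ordLess_trans[OF omega1(2) aleph1_ordLess_\<kappa>]])

lemma omega_in_H: "omega \<in> H \<kappa>"
  by (rule ordinal_in_H[OF omega(1) ordIso_ordLess_trans[OF omega(2)
          ordLess_transitive[OF natLeq_ordLess_aleph1 aleph1_ordLess_\<kappa>]]])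

text \<open>A union of ordinals below \<open>omega2\<close> is an ordinal contained in
  \<open>omega2\<close>. The purpose is to leave only \<open>aleph2\<close> possible values of
  \<open>delta\<close>; admitting \<open>omega2\<close> among them avoids any argument about
  cofinalities.\<close>

lemma delta_cases:
  fixes Q :: "'k hset"
  shows "delta Q \<in> insert omega2 (elts omega2)"
proof -
  let ?A = "\<Union>\<alpha>\<in>elts Q \<inter> elts omega2. elts \<alpha>"
  have sub: "?A \<subseteq> elts omega2"
    using omega2(1) by (auto simp: ordinal_def transitive_def)
  have "|elts (omega2 :: 'k hset)| \<le>o |UNIV :: 'k set|"
    using omega2(2) aleph_ordLeq_UNIV(3) by (rule ordIso_ordLeq_trans)
  then have elts: "elts (delta Q) = ?A"
    unfolding delta_def by (intro elts_vset card_of_subset_ordLeq[OF sub])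
  have "ordinal \<alpha>" if "mem \<alpha> omega2" for \<alpha> :: "'k hset" using ordinal_mem omega2(1) that by blast
  then have "ordinal (delta Q)"
    unfolding ordinal_def transitive_def elts by blast
  then have "mem (delta Q) omega2 \<or> delta Q = omega2 \<or> mem omega2 (delta Q)"
    using omega2(1) by (rule ordinal_linear)
  then show ?thesis using sub mem_irrefl elts by blast
qed

section \<open>Limit ordinals and a first-order description of \<open>omega\<close>\<close>

definition limit_ordinal :: "'k hset \<Rightarrow> bool" where
  "limit_ordinal x \<longleftrightarrow> ordinal x \<and> (\<exists>y. mem y x) \<and> (\<forall>y\<in>elts x. \<exists>z\<in>elts x. mem y z)"

text \<open>On a finite ordinal the converse of membership is acyclic and therefore well-founded. A
  minimal element for it is a largest member of \<open>x\<close>, which a limit ordinal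
  lacks.\<close>

lemma limit_ordinal_infinite:
  assumes "limit_ordinal x"
  shows "infinite (elts x)"
proof
  assume fin: "finite (elts x)"
  let ?R = "{(z, y). mem y z \<and> mem z x \<and> mem y x}"
  have "acyclic ?R"
  proof -
    have "mem b a" if "(a, b) \<in> ?R\<^sup>+" for a b
      using that
    proof (induction rule: trancl_induct)
      case (step b c)
      then have "transitive a"
        using assms by (auto simp: limit_ordinal_def ordinal_def dest: tranclD)
      then show ?case using step by (auto simp: transitive_def)
    qed simp
    then show ?thesis using mem_irrefl unfolding acyclic_def by meson
  qed
  moreover have "finite ?R"
    by (rule finite_subset[of _ "elts x \<times> elts x"]) (auto simp: fin)
  ultimately have wf: "wf ?R" using finite_acyclic_wf by blast
  obtain y where "mem y x" using assms by (auto simp: limit_ordinal_def)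
  then have "\<exists>m\<in>elts x. \<forall>z. (z, m) \<in> ?R \<longrightarrow> z \<notin> elts x"
    using wf[unfolded wf_eq_minimal, rule_format] by blast
  then obtain m where m: "mem m x" "\<And>z. (z, m) \<in> ?R \<Longrightarrow> \<not> mem z x" by blast
  then obtain z where "mem z x" "mem m z" using assms unfolding limit_ordinal_def by blast
  then show False using m(1) m(2)[of z] by blast
qed

text \<open>This replaces the cardinality in the definition of \<open>omega\<close> by a condition
  that a formula can express. It holds because \<open>omega\<close> is infinite with finite members,
  while limit ordinals are infinite.\<close>

lemma omega_iff_least_limit:
  "x = omega \<longleftrightarrow> limit_ordinal x \<and> (\<forall>y\<in>elts x. \<not> limit_ordinal y)"
proof -
  have inf: "infinite (elts (omega :: 'k hset))"
    using card_of_ordIso_finite[OF ordIso_transitive[OF omega(2) ordIso_symmetric[OF card_of_nat]]]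
    by simp
  have fin: "finite (elts y)" if "mem y (omega :: 'k hset)" for y
    using omega(3)[OF that] by (simp add: finite_iff_ordLess_natLeq)
  have lim: "limit_ordinal omega"
    unfolding limit_ordinal_def
  proof (intro conjI ballI omega(1))
    show "\<exists>y :: 'k hset. mem y omega" using inf infinite_imp_nonempty by blast
    fix y :: "'k hset" assume y: "mem y omega"
    \<comment> \<open>Otherwise, by linearity, every member of \<open>omega\<close> is
      \<open>y\<close> or a member of \<open>y\<close>, and \<open>omega\<close> would be
      finite.\<close>
    show "\<exists>z\<in>elts omega. mem y z"
    proof (rule ccontr)
      assume "\<not> ?thesis"
      then have "elts (omega :: 'k hset) \<subseteq> insert y (elts y)"
        using ordinal_linear[of _ y] ordinal_mem[OF omega(1)] y by blast
      then show False using inf fin[OF y] finite_subset by blast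
    qed
  qed
  have least: "\<not> limit_ordinal y" if "mem y omega" for y
    using fin[OF that] limit_ordinal_infinite by blast
  show ?thesis
  proof
    assume R: "limit_ordinal x \<and> (\<forall>y\<in>elts x. \<not> limit_ordinal y)"
    then have "ordinal x" by (simp add: limit_ordinal_def)
    then show "x = omega" using ordinal_linear[OF _ omega(1)] R lim least by blast
  qed (use lim least in blast)
qed

end

section \<open>Definability of \<open>\<omega>\<^sub>1\<close> in \<open>H(\<kappa>)\<close>\<close>

abbreviation "Or \<phi> \<psi> \<equiv> Neg (And (Neg \<phi>) (Neg \<psi>))"
abbreviation "Imp \<phi> \<psi> \<equiv> Neg (And \<phi> (Neg \<psi>))"
abbreviation "Iff \<phi> \<psi> \<equiv> And (Imp \<phi> \<psi>) (Imp \<psi> \<phi>)"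
abbreviation "Forall i \<phi> \<equiv> Neg (Ex i (Neg \<phi>))"

text \<open>
  In these formulas every bound variable has a larger index than the free ones, so that nothing is
  captured when they are nested.
\<close>

definition upair_fm :: "nat \<Rightarrow> nat \<Rightarrow> nat \<Rightarrow> fm" where
  "upair_fm z a b = (let k = z + a + b + 1 in Forall k (Iff (Mem k z) (Or (Eq k a) (Eq k b))))"

definition pair_fm :: "nat \<Rightarrow> nat \<Rightarrow> nat \<Rightarrow> fm" where
  "pair_fm p a b = (let k = p + a + b + 1 in Forall k (Iff (Mem k p) (Or (upair_fm k a a) (upair_fm k a b))))"

definition transitive_fm :: "nat \<Rightarrow> fm" where
  "transitive_fm x =
     Forall (x + 1) (Imp (Mem (x + 1) x) (Forall (x + 2) (Imp (Mem (x + 2) (x + 1)) (Mem (x + 2) x))))"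

definition ordinal_fm :: "nat \<Rightarrow> fm" where
  "ordinal_fm x = And (transitive_fm x) (Forall (x + 1) (Imp (Mem (x + 1) x) (transitive_fm (x + 1))))"

definition limit_fm :: "nat \<Rightarrow> fm" where
  "limit_fm x = And (ordinal_fm x) (And (Ex (x + 1) (Mem (x + 1) x))
     (Forall (x + 1) (Imp (Mem (x + 1) x) (Ex (x + 2) (And (Mem (x + 2) x) (Mem (x + 1) (x + 2)))))))"

definition omega_fm :: "nat \<Rightarrow> fm" where
  "omega_fm x = And (limit_fm x) (Forall (x + 1) (Imp (Mem (x + 1) x) (Neg (limit_fm (x + 1)))))"

definition pair_mem_fm :: "nat \<Rightarrow> nat \<Rightarrow> nat \<Rightarrow> fm" where
  "pair_mem_fm a b f = (let k = a + b + f + 1 in Ex k (And (Mem k f) (pair_fm k a b)))"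

text \<open>The relation \<open>f\<close> gives each member of \<open>y\<close> at least one index
  \<open>n\<close> in \<open>omega\<close>, and no index belongs to two sets. Choosing one index per
  member yields an injection.\<close>

definition countable_fm :: "nat \<Rightarrow> fm" where
  "countable_fm y = (let w = y + 1; f = y + 2; a = y + 3; b = y + 4; n = y + 5 in
     Ex w (And (omega_fm w) (Ex f (And
       (Forall a (Imp (Mem a y) (Ex n (And (Mem n w) (pair_mem_fm a n f)))))
       (Forall a (Forall b (Forall n (Imp (And (pair_mem_fm a n f) (pair_mem_fm b n f)) (Eq a b)))))))))"

definition omega1_fm :: "nat \<Rightarrow> fm" where
  "omega1_fm w = And (ordinal_fm w)
     (And (Neg (countable_fm w)) (Forall (w + 1) (Imp (Mem (w + 1) w) (countable_fm (w + 1)))))"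

text \<open>Variable 2 is bound to \<open>omega1\<close>, so the constant function (variable 0) is
  defined from its value (variable 1) as the only parameter.\<close>

definition const_fm :: fm where
  "const_fm = Ex 2 (And (omega1_fm 2) (Forall 3 (Iff (Mem 3 0) (Ex 4 (And (Mem 4 2) (pair_fm 3 4 1))))))"

lemma elementary_submodel_sat:
  "elementary_submodel M N \<Longrightarrow> (\<And>i. e i \<in> M) \<Longrightarrow> sat M e \<phi> \<longleftrightarrow> sat N e \<phi>"
  by (simp add: elementary_submodel_def)

context large_regular
begin

text \<open>\<open>H \<kappa>\<close> is transitive, so quantifiers restricted to it see all members
  of its elements.\<close>

lemma eq_iff_in_H:
  "x \<in> H \<kappa> \<Longrightarrow> y \<in> H \<kappa> \<Longrightarrow> x = y \<longleftrightarrow> (\<forall>z\<in>H \<kappa>. mem z x \<longleftrightarrow> mem z y)"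
  using elts_inject[of x y] H_mem[of _ \<kappa>] by blast

lemma sat_upair_fm:
  assumes "\<forall>i. e i \<in> H \<kappa>"
  shows "sat (H \<kappa>) e (upair_fm z a b) \<longleftrightarrow> e z = vset {e a, e b}"
proof -
  have "vset {e a, e b} \<in> H \<kappa>" using assms by (intro vset_in_H finite_ordLess_\<kappa>) auto
  then have "e z = vset {e a, e b} \<longleftrightarrow> (\<forall>k\<in>H \<kappa>. mem k (e z) \<longleftrightarrow> k = e a \<or> k = e b)"
    using assms eq_iff_in_H[of "e z" "vset {e a, e b}"] by (simp add: elts_vset_finite)
  then show ?thesis by (auto simp: upair_fm_def Let_def)
qed

lemma sat_pair_fm:
  assumes "\<forall>i. e i \<in> H \<kappa>"
  shows "sat (H \<kappa>) e (pair_fm p a b) \<longleftrightarrow> e p = vpair (e a) (e b)"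
proof -
  have "vpair (e a) (e b) \<in> H \<kappa>" using assms by (intro vpair_in_H) auto
  moreover have "elts (vpair (e a) (e b)) = {vset {e a}, vset {e a, e b}}"
    unfolding vpair_def by (intro elts_vset_finite) simp
  ultimately have "e p = vpair (e a) (e b) \<longleftrightarrow>
      (\<forall>k\<in>H \<kappa>. mem k (e p) \<longleftrightarrow> k = vset {e a} \<or> k = vset {e a, e b})"
    using assms eq_iff_in_H[of "e p" "vpair (e a) (e b)"] by simp
  then show ?thesis using assms by (auto simp: pair_fm_def Let_def sat_upair_fm)
qed

lemma sat_transitive_fm:
  assumes "\<forall>i. e i \<in> H \<kappa>"
  shows "sat (H \<kappa>) e (transitive_fm x) \<longleftrightarrow> transitive (e x)"
  using assms by (simp add: transitive_fm_def transitive_def subset_iff) (blast intro: H_mem)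

lemma sat_ordinal_fm:
  assumes "\<forall>i. e i \<in> H \<kappa>"
  shows "sat (H \<kappa>) e (ordinal_fm x) \<longleftrightarrow> ordinal (e x)"
  using assms H_mem[of "e x" \<kappa>] by (auto simp: ordinal_fm_def ordinal_def sat_transitive_fm)

lemma sat_limit_fm:
  assumes "\<forall>i. e i \<in> H \<kappa>"
  shows "sat (H \<kappa>) e (limit_fm x) \<longleftrightarrow> limit_ordinal (e x)"
  using assms H_mem[of "e x" \<kappa>]
  by (simp add: limit_fm_def limit_ordinal_def sat_ordinal_fm) blast

lemma sat_omega_fm:
  assumes "\<forall>i. e i \<in> H \<kappa>"
  shows "sat (H \<kappa>) e (omega_fm x) \<longleftrightarrow> e x = omega"
  using assms H_mem[of "e x" \<kappa>]
  by (auto simp: omega_fm_def omega_iff_least_limit sat_limit_fm)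

lemma sat_pair_mem_fm:
  assumes "\<forall>i. e i \<in> H \<kappa>"
  shows "sat (H \<kappa>) e (pair_mem_fm a b f) \<longleftrightarrow> mem (vpair (e a) (e b)) (e f)"
  using assms vpair_in_H
  by (auto simp: pair_mem_fm_def Let_def sat_pair_fm)

text \<open>Countability is absolute for \<open>H \<kappa>\<close>: the graph of an injection from a
  countable member of \<open>H \<kappa>\<close> into \<open>omega\<close> is a countable set of
  pairs from \<open>H \<kappa>\<close>, hence itself in \<open>H \<kappa>\<close>.\<close>

lemma sat_countable_fm:
  assumes e: "\<forall>i. e i \<in> H \<kappa>"
  shows "sat (H \<kappa>) e (countable_fm y) \<longleftrightarrow> countable (elts (e y))"
proof -
  have "sat (H \<kappa>) e (countable_fm y) \<longleftrightarrow> (\<exists>f\<in>H \<kappa>.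
      (\<forall>a\<in>elts (e y). \<exists>n\<in>elts omega. mem (vpair a n) f) \<and>
      (\<forall>a\<in>H \<kappa>. \<forall>b\<in>H \<kappa>. \<forall>n\<in>H \<kappa>. mem (vpair a n) f \<and> mem (vpair b n) f \<longrightarrow> a = b))"
    using e omega_in_H H_mem[of "e y" \<kappa>] H_mem[of omega \<kappa>]
    by (simp add: countable_fm_def Let_def sat_omega_fm sat_pair_mem_fm cong: conj_cong bex_cong) blast
  also have "\<dots> \<longleftrightarrow> countable (elts (e y))"
  proof
    assume "\<exists>f\<in>H \<kappa>.
      (\<forall>a\<in>elts (e y). \<exists>n\<in>elts omega. mem (vpair a n) f) \<and>
      (\<forall>a\<in>H \<kappa>. \<forall>b\<in>H \<kappa>. \<forall>n\<in>H \<kappa>. mem (vpair a n) f \<and> mem (vpair b n) f \<longrightarrow> a = b)"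
    then obtain f where f: "\<forall>a\<in>elts (e y). \<exists>n\<in>elts omega. mem (vpair a n) f"
      "\<And>a b n. a \<in> H \<kappa> \<Longrightarrow> b \<in> H \<kappa> \<Longrightarrow> n \<in> H \<kappa> \<Longrightarrow> mem (vpair a n) f \<Longrightarrow> mem (vpair b n) f \<Longrightarrow> a = b"
      by blast
    from f(1) obtain g where
      g: "\<And>a. mem a (e y) \<Longrightarrow> mem (g a) omega \<and> mem (vpair a (g a)) f" by metis
    have "inj_on g (elts (e y))"
    proof (rule inj_onI)
      fix a b assume ab: "mem a (e y)" "mem b (e y)" "g a = g b"
      then have "a \<in> H \<kappa>" "b \<in> H \<kappa>" "g a \<in> H \<kappa>"
        using e g omega_in_H H_mem by blast+
      then show "a = b" using f(2) g ab by metis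
    qed
    moreover have "countable (elts (omega :: 'k hset))"
      unfolding countable_card_le_natLeq by (rule ordIso_imp_ordLeq[OF omega(2)])
    then have "countable (g ` elts (e y))" by (rule countable_subset[rotated]) (use g in auto)
    ultimately show "countable (elts (e y))" using countable_image_inj_on by blast
  next
    assume "countable (elts (e y))"
    then have le: "|elts (e y)| \<le>o natLeq" by (simp add: countable_card_le_natLeq)
    have "|elts (e y)| \<le>o |elts (omega :: 'k hset)|"
      by (rule ordLeq_ordIso_trans[OF le ordIso_symmetric[OF omega(2)]])
    then obtain g where g: "inj_on g (elts (e y))" "g ` elts (e y) \<subseteq> elts (omega :: 'k hset)"
      unfolding card_of_ordLeq[symmetric] by blast
    let ?F = "(\<lambda>a. vpair a (g a)) ` elts (e y)"
    have lt: "|?F| <o \<kappa>"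
      by (rule ordLeq_ordLess_trans[OF card_of_image_ordLeq[OF le]
            ordLess_transitive[OF natLeq_ordLess_aleph1 aleph1_ordLess_\<kappa>]])
    have F: "vset ?F \<in> H \<kappa>"
    proof (rule vset_in_H[OF _ lt])
      show "?F \<subseteq> H \<kappa>"
      proof (rule image_subsetI)
        fix a assume "mem a (e y)"
        then show "vpair a (g a) \<in> H \<kappa>"
          using e g(2) H_mem[of "e y" \<kappa>] H_mem[OF omega_in_H] by (intro vpair_in_H) auto
      qed
    qed
    have mem_F: "mem (vpair a n) (vset ?F) \<longleftrightarrow> mem a (e y) \<and> n = g a" for a n
      unfolding elts_vset_ordLess[OF lt] by (auto simp: vpair_inject)
    show "\<exists>f\<in>H \<kappa>.
      (\<forall>a\<in>elts (e y). \<exists>n\<in>elts omega. mem (vpair a n) f) \<and>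
      (\<forall>a\<in>H \<kappa>. \<forall>b\<in>H \<kappa>. \<forall>n\<in>H \<kappa>. mem (vpair a n) f \<and> mem (vpair b n) f \<longrightarrow> a = b)"
      using g by (intro bexI[OF _ F]) (auto simp: mem_F inj_on_def)
  qed
  finally show ?thesis .
qed

text \<open>As for \<open>omega\<close>, this turns a definition by cardinality into one that a
  formula can express.\<close>

lemma omega1_iff_least_uncountable:
  fixes w :: "'k hset"
  shows "w = omega1 \<longleftrightarrow> ordinal w \<and> uncountable (elts w) \<and> (\<forall>y\<in>elts w. countable (elts y))"
proof -
  have unc: "uncountable (elts (omega1 :: 'k hset))"
    unfolding countable_iff_ordLess_aleph1 using not_ordLess_ordIso omega1(2) by blast
  have cnt: "countable (elts y)" if "mem y (omega1 :: 'k hset)" for y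
    using omega1(3)[OF that] unfolding countable_iff_ordLess_aleph1 .
  show ?thesis
  proof
    assume R: "ordinal w \<and> uncountable (elts w) \<and> (\<forall>y\<in>elts w. countable (elts y))"
    then have "mem w omega1 \<or> w = omega1 \<or> mem omega1 w"
      using omega1(1) by (intro ordinal_linear) auto
    then show "w = omega1" using R unc cnt by blast
  qed (use omega1(1) unc cnt in blast)
qed

lemma sat_omega1_fm:
  assumes "\<forall>i. e i \<in> H \<kappa>"
  shows "sat (H \<kappa>) e (omega1_fm w) \<longleftrightarrow> e w = omega1"
  using assms H_mem[of "e w" \<kappa>]
  by (auto simp: omega1_fm_def omega1_iff_least_uncountable sat_ordinal_fm sat_countable_fm)

section \<open>Constant functions on \<open>omega1\<close>, and extensionality of elementary
  submodels\<close>

definition const_fun :: "'k hset \<Rightarrow> 'k hset" where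
  "const_fun x = vset ((\<lambda>a. vpair a x) ` elts omega1)"

lemma elts_const_fun: "elts (const_fun x) = (\<lambda>a. vpair a x) ` elts omega1"
  and const_fun_in_H: "x \<in> H \<kappa> \<Longrightarrow> const_fun x \<in> H \<kappa>"
proof -
  have lt: "|(\<lambda>a. vpair a x) ` elts omega1| <o \<kappa>"
    by (rule ordLeq_ordLess_trans[OF card_of_image ordIso_ordLess_trans[OF omega1(2) aleph1_ordLess_\<kappa>]])
  show "elts (const_fun x) = (\<lambda>a. vpair a x) ` elts omega1"
    unfolding const_fun_def by (rule elts_vset_ordLess[OF lt])
  show "const_fun x \<in> H \<kappa>" if "x \<in> H \<kappa>"
    unfolding const_fun_def using that H_mem[OF omega1_in_H]
    by (intro vset_in_H[OF _ lt] image_subsetI vpair_in_H)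
qed

lemma sat_const_fm:
  assumes "\<forall>i. e i \<in> H \<kappa>"
  shows "sat (H \<kappa>) e const_fm \<longleftrightarrow> e 0 = const_fun (e 1)"
proof -
  have "sat (H \<kappa>) e const_fm \<longleftrightarrow>
      (\<forall>p\<in>H \<kappa>. mem p (e 0) \<longleftrightarrow> (\<exists>a\<in>elts omega1. p = vpair a (e 1)))"
    using assms omega1_in_H H_mem[of omega1 \<kappa>]
    by (simp add: const_fm_def sat_omega1_fm sat_pair_fm cong: conj_cong bex_cong) blast
  also have "\<dots> \<longleftrightarrow> e 0 = const_fun (e 1)"
    using assms const_fun_in_H eq_iff_in_H[of "e 0" "const_fun (e 1)"]
    by (simp add: elts_const_fun image_iff)
  finally show ?thesis .
qed

lemma function_on_const_fun: "function_on (const_fun x) omega1"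
  unfolding function_on_def elts_const_fun by (auto simp: vpair_inject)

lemma app_const_fun: "mem a omega1 \<Longrightarrow> app (const_fun x) a = x"
  unfolding app_def elts_const_fun by (auto simp: vpair_inject)

text \<open>\<open>const_fun x\<close> is the unique solution of \<open>const_fm\<close> with
  parameter \<open>x\<close>, so elementarity puts it into \<open>Q\<close>; its value at any
  countable ordinal is \<open>x\<close>.\<close>

lemma elts_subset_hull1:
  assumes Q: "elementary_submodel (elts Q) (H \<kappa>)"
  shows "elts Q \<subseteq> Q[\<omega>\<^sub>1]"
proof
  fix x assume x: "mem x Q"
  have sub: "elts Q \<subseteq> H \<kappa>" using Q by (simp add: elementary_submodel_def)
  \<comment> \<open>Every variable is assigned \<open>x\<close>, in particular the parameter 1; the
    witness for variable 0 is \<open>const_fun x\<close>.\<close>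
  have "sat (H \<kappa>) (\<lambda>_. x) (Ex 0 const_fm)"
    using x sub const_fun_in_H by (auto simp: sat_const_fm)
  then have "sat (elts Q) (\<lambda>_. x) (Ex 0 const_fm)"
    by (rule iffD2[OF elementary_submodel_sat[OF Q], rotated]) (rule x)
  then obtain f where f: "mem f Q" "sat (elts Q) ((\<lambda>_. x)(0 := f)) const_fm"
    by auto
  then have "sat (H \<kappa>) ((\<lambda>_. x)(0 := f)) const_fm"
    using x by (intro iffD1[OF elementary_submodel_sat[OF Q]]) auto
  then have "f = const_fun x" using f(1) x sub by (subst (asm) sat_const_fm) auto
  moreover obtain a :: "'k hset" where "mem a omega1"
    using omega1_iff_least_uncountable[of omega1] by (metis countable_empty ex_in_conv)
  ultimately have "x = app f a" "function_on f omega1"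
    using function_on_const_fun app_const_fun by simp_all
  with f(1) \<open>mem a omega1\<close> show "x \<in> Q[\<omega>\<^sub>1]"
    unfolding hull1_def by blast
qed

text \<open>\<open>elts Q\<close> need not be transitive. Still, that no member of \<open>Q\<close>
  separates \<open>x\<close> from \<open>y\<close> is a first-order statement about them, so it
  passes to \<open>H \<kappa>\<close>, where extensionality holds.\<close>

lemma elementary_submodel_extensional:
  assumes Q: "elementary_submodel (elts Q) (H \<kappa>)" and xy: "mem x Q" "mem y Q"
    and eq: "\<And>z. mem z Q \<Longrightarrow> mem z x \<longleftrightarrow> mem z y"
  shows "x = y"
proof -
  let ?e = "(\<lambda>_. x)(1 := y)"
  let ?\<phi> = "Forall 2 (Iff (Mem 2 0) (Mem 2 1))"
  have sub: "elts Q \<subseteq> H \<kappa>" using Q by (simp add: elementary_submodel_def)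
  have "sat (elts Q) ?e ?\<phi>" using eq by auto
  then have "sat (H \<kappa>) ?e ?\<phi>"
    using xy by (intro iffD1[OF elementary_submodel_sat[OF Q]]) auto
  then show ?thesis using eq_iff_in_H[of x y] xy sub by auto
qed

end

section \<open>Amalgamation of isomorphic systems\<close>

lemma model_iso_id: "model_iso Q Q id"
  by (auto simp: model_iso_def)

lemma model_iso_Psi:
  assumes "Q0 = Q1 \<or> (\<exists>F. model_iso Q0 Q1 F)"
  shows "model_iso Q0 Q1 (Psi Q0 Q1)"
proof (cases "Q0 = Q1")
  case True
  then show ?thesis by (simp add: Psi_def model_iso_id)
next
  case False
  then show ?thesis using assms someI_ex[of "model_iso Q0 Q1"] by (simp add: Psi_def)
qed

text \<open>
  Uniqueness is only claimed on \<open>Q0\<close>, not on its hull: there extensionality of \<open>Q1\<close> suffices.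
\<close>

lemma model_iso_unique:
  assumes F: "model_iso Q0 Q1 F" and G: "model_iso Q0 Q1 G"
    and sub: "elts Q0 \<subseteq> Q0[\<omega>\<^sub>1]" "elts Q1 \<subseteq> Q1[\<omega>\<^sub>1]"
    and ext: "\<And>x y. mem x Q1 \<Longrightarrow> mem y Q1 \<Longrightarrow> (\<And>z. mem z Q1 \<Longrightarrow> mem z x \<longleftrightarrow> mem z y) \<Longrightarrow> x = y"
    and x: "mem x Q0"
  shows "F x = G x"
  using x
proof (induction x rule: hset_induct)
  case (1 x)
  have into: "mem (F' y) Q1" if "model_iso Q0 Q1 F'" "mem y Q0" for F' y
    using that sub(1) unfolding model_iso_def by blast
  \<comment> \<open>Stated for arbitrary \<open>F'\<close> and \<open>G'\<close> because it is used
    in both directions. The preimage of \<open>z\<close> under \<open>F'\<close> lies in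
    \<open>x\<close> and in \<open>Q0\<close>, where the induction hypothesis applies.\<close>
  have step: "mem z (G' x)"
    if F': "model_iso Q0 Q1 F'" and G': "model_iso Q0 Q1 G'"
      and IH: "\<And>y. mem y x \<Longrightarrow> mem y Q0 \<Longrightarrow> F' y = G' y"
      and z: "mem z Q1" "mem z (F' x)" for F' G' z
  proof -
    have "z \<in> F' ` (Q0[\<omega>\<^sub>1])" using F' z(1) sub(2) unfolding model_iso_def bij_betw_def by blast
    then obtain y where y: "y \<in> Q0[\<omega>\<^sub>1]" "z = F' y" by blast
    have yQ: "mem y Q0" using F' y z(1) unfolding model_iso_def by blast
    have x: "x \<in> Q0[\<omega>\<^sub>1]" using 1(2) sub(1) by blast
    have yx: "mem y x" using F' y x z(2) unfolding model_iso_def by blast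
    then have "mem (G' y) (G' x)" using G' y x unfolding model_iso_def by blast
    then show ?thesis using IH[OF yx yQ] y by simp
  qed
  show ?case
  proof (rule ext)
    show "mem (F x) Q1" "mem (G x) Q1" using into F G 1(2) by blast+
    show "mem z (F x) \<longleftrightarrow> mem z (G x)" if "mem z Q1" for z
      using step[OF F G 1(1) that] step[OF G F 1(1)[symmetric] that] by blast
  qed
qed

text \<open>The identity clause does not compose by itself: a common point of the hulls of
  \<open>Q0\<close> and \<open>Q2\<close> need not lie in the hull of \<open>Q1\<close>. Hence the
  hypothesis \<open>fixed\<close>.\<close>

lemma model_iso_comp:
  assumes F: "model_iso Q0 Q1 F" and G: "model_iso Q1 Q2 G"
    and fixed: "\<And>x. x \<in> Q0[\<omega>\<^sub>1] \<Longrightarrow> x \<in> Q2[\<omega>\<^sub>1] \<Longrightarrow> G (F x) = x"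
  shows "model_iso Q0 Q2 (G \<circ> F)"
proof -
  have into: "F x \<in> Q1[\<omega>\<^sub>1]" if "x \<in> Q0[\<omega>\<^sub>1]" for x
    using F that unfolding model_iso_def by (auto dest: bij_betwE)
  show ?thesis
    unfolding model_iso_def
  proof (intro conjI ballI)
    show "bij_betw (G \<circ> F) (Q0[\<omega>\<^sub>1]) (Q2[\<omega>\<^sub>1])"
      using F G bij_betw_trans unfolding model_iso_def by blast
    show "mem x y \<longleftrightarrow> mem ((G \<circ> F) x) ((G \<circ> F) y)" if "x \<in> Q0[\<omega>\<^sub>1]" "y \<in> Q0[\<omega>\<^sub>1]" for x y
      using F G that into unfolding model_iso_def by simp
    show "mem x Q0 \<longleftrightarrow> mem ((G \<circ> F) x) Q2" if "x \<in> Q0[\<omega>\<^sub>1]" for x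
      using F G that into unfolding model_iso_def by simp
    show "(G \<circ> F) x = x" if "x \<in> Q0[\<omega>\<^sub>1] \<inter> Q2[\<omega>\<^sub>1]" for x
      using fixed that by simp
  qed
qed

text \<open>
  The support contains the models themselves. Hence a model of \<open>p\<close> that belongs to (the hull of) a
  model of \<open>q\<close> lies in the intersection of the supports, is fixed by \<open>\<Phi>\<close>, and so is a model of \<open>q\<close>.
\<close>

definition support :: "'k hset set \<Rightarrow> 'k hset set" where
  "support p = p \<union> (\<Union>Q\<in>p. elts Q \<union> Q[\<omega>\<^sub>1])"

text \<open>The membership clause also covers membership in the models, as these lie in the support.
  Hulls and \<open>delta\<close> refer to sets that may lie outside it and get clauses of their
  own.\<close>

definition system_iso :: "'k hset set \<Rightarrow> 'k hset set \<Rightarrow> ('k hset \<Rightarrow> 'k hset) \<Rightarrow> bool" where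
  "system_iso p q \<Phi> \<longleftrightarrow> bij_betw \<Phi> (support p) (support q) \<and> \<Phi> ` p = q \<and>
     (\<forall>x\<in>support p. \<forall>y\<in>support p. mem x y \<longleftrightarrow> mem (\<Phi> x) (\<Phi> y)) \<and>
     (\<forall>Q\<in>p. \<forall>x\<in>support p. x \<in> Q[\<omega>\<^sub>1] \<longleftrightarrow> \<Phi> x \<in> (\<Phi> Q)[\<omega>\<^sub>1]) \<and>
     (\<forall>Q\<in>p. delta (\<Phi> Q) = delta Q) \<and>
     (\<forall>x\<in>support p \<inter> support q. \<Phi> x = x)"

text \<open>With this, every statement about models of \<open>p\<close> facing models of
  \<open>q\<close> can be used with the roles exchanged.\<close>

lemma system_iso_sym:
  assumes "system_iso p q \<Phi>"
  shows "system_iso q p (inv_into (support p) \<Phi>)"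
proof -
  let ?\<Psi> = "inv_into (support p) \<Phi>"
  have bij: "bij_betw \<Phi> (support p) (support q)" and im: "\<Phi> ` p = q"
    and mem: "\<And>x y. x \<in> support p \<Longrightarrow> y \<in> support p \<Longrightarrow> mem x y \<longleftrightarrow> mem (\<Phi> x) (\<Phi> y)"
    and hull: "\<And>Q x. Q \<in> p \<Longrightarrow> x \<in> support p \<Longrightarrow> x \<in> Q[\<omega>\<^sub>1] \<longleftrightarrow> \<Phi> x \<in> (\<Phi> Q)[\<omega>\<^sub>1]"
    and delta: "\<And>Q. Q \<in> p \<Longrightarrow> delta (\<Phi> Q) = delta Q"
    and fixed: "\<And>x. x \<in> support p \<Longrightarrow> x \<in> support q \<Longrightarrow> \<Phi> x = x"
    using assms unfolding system_iso_def by auto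
  have p_sub: "p \<subseteq> support p" and q_sub: "q \<subseteq> support q" by (auto simp: support_def)
  have \<Phi>\<Psi>: "\<Phi> (?\<Psi> x) = x" "?\<Psi> x \<in> support p" if "x \<in> support q" for x
    using bij that by (auto simp: bij_betw_inv_into_right inv_into_into bij_betw_def f_inv_into_f)
  have \<Psi>\<Phi>: "?\<Psi> (\<Phi> x) = x" if "x \<in> support p" for x
    using bij that by (rule bij_betw_inv_into_left)
  have in_p: "?\<Psi> Q \<in> p" if "Q \<in> q" for Q
    using that im \<Psi>\<Phi> p_sub by auto
  show ?thesis
    unfolding system_iso_def
  proof (intro conjI ballI)
    show "bij_betw ?\<Psi> (support q) (support p)" using bij by (rule bij_betw_inv_into)
    show "?\<Psi> ` q = p" using im \<Psi>\<Phi> p_sub by (force simp: image_iff)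
    show "mem x y \<longleftrightarrow> mem (?\<Psi> x) (?\<Psi> y)" if "x \<in> support q" "y \<in> support q" for x y
      using that mem[of "?\<Psi> x" "?\<Psi> y"] \<Phi>\<Psi> by simp
    show "x \<in> Q[\<omega>\<^sub>1] \<longleftrightarrow> ?\<Psi> x \<in> (?\<Psi> Q)[\<omega>\<^sub>1]" if "Q \<in> q" "x \<in> support q" for Q x
      using that q_sub hull[of "?\<Psi> Q" "?\<Psi> x"] in_p \<Phi>\<Psi> by (simp add: subset_iff)
    show "delta (?\<Psi> Q) = delta Q" if "Q \<in> q" for Q
      using that q_sub delta[of "?\<Psi> Q"] in_p \<Phi>\<Psi> by (simp add: subset_iff)
    show "?\<Psi> x = x" if "x \<in> support q \<inter> support p" for x
      using that fixed[of x] \<Psi>\<Phi>[of x] by simp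
  qed
qed

lemma system_iso_shared_model:
  assumes "system_iso p q \<Phi>" "Q \<in> p" "Q \<in> support q"
  shows "Q \<in> q"
proof -
  have "\<Phi> Q = Q" using assms unfolding system_iso_def support_def by blast
  then show ?thesis using assms unfolding system_iso_def by (metis imageI)
qed

lemma system_iso_model_iso:
  assumes \<Phi>: "system_iso p q \<Phi>" and Q: "Q \<in> p"
  shows "model_iso Q (\<Phi> Q) \<Phi>"
proof -
  have sub: "Q[\<omega>\<^sub>1] \<subseteq> support p" "Q \<in> support p" using Q by (auto simp: support_def)
  have \<Phi>Q: "\<Phi> Q \<in> q" using \<Phi> Q unfolding system_iso_def by blast
  then have sub': "(\<Phi> Q)[\<omega>\<^sub>1] \<subseteq> support q" by (auto simp: support_def)
  have "\<Phi> ` (Q[\<omega>\<^sub>1]) = (\<Phi> Q)[\<omega>\<^sub>1]"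
  proof (intro subset_antisym subsetI)
    fix y assume "y \<in> \<Phi> ` (Q[\<omega>\<^sub>1])"
    then show "y \<in> (\<Phi> Q)[\<omega>\<^sub>1]" using \<Phi> Q sub unfolding system_iso_def by blast
  next
    fix y assume y: "y \<in> (\<Phi> Q)[\<omega>\<^sub>1]"
    then obtain x where "x \<in> support p" "y = \<Phi> x"
      using \<Phi> sub' unfolding system_iso_def bij_betw_def by blast
    then show "y \<in> \<Phi> ` (Q[\<omega>\<^sub>1])" using \<Phi> Q y unfolding system_iso_def by blast
  qed
  moreover have "inj_on \<Phi> (Q[\<omega>\<^sub>1])"
    using \<Phi> by (intro inj_on_subset[OF _ sub(1)]) (simp add: system_iso_def bij_betw_def)
  ultimately have bij: "bij_betw \<Phi> (Q[\<omega>\<^sub>1]) ((\<Phi> Q)[\<omega>\<^sub>1])" by (simp add: bij_betw_def)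
  have mem: "mem x y \<longleftrightarrow> mem (\<Phi> x) (\<Phi> y)" if "x \<in> support p" "y \<in> support p" for x y
    using \<Phi> that unfolding system_iso_def by blast
  have fixed: "\<Phi> x = x" if "x \<in> support p" "x \<in> support q" for x
    using \<Phi> that unfolding system_iso_def by blast
  show ?thesis
    unfolding model_iso_def
  proof (intro conjI ballI bij)
    show "mem x y \<longleftrightarrow> mem (\<Phi> x) (\<Phi> y)" if "x \<in> Q[\<omega>\<^sub>1]" "y \<in> Q[\<omega>\<^sub>1]" for x y
      using mem that sub(1) by blast
    show "mem x Q \<longleftrightarrow> mem (\<Phi> x) (\<Phi> Q)" if "x \<in> Q[\<omega>\<^sub>1]" for x
      using mem that sub by blast
    show "\<Phi> x = x" if "x \<in> Q[\<omega>\<^sub>1] \<inter> (\<Phi> Q)[\<omega>\<^sub>1]" for x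
      using fixed that sub(1) sub' by blast
  qed
qed

section \<open>The union of two isomorphic conditions\<close>

context large_regular
begin

text \<open>Clauses (A) to (F) as separate rules. In (B) equal models are covered by the identity,
  and in (C) distinctness follows from irreflexivity of membership.\<close>

lemma symmetric_systemD:
  assumes "symmetric_system \<kappa> p"
  shows "finite p" "p \<subseteq> H \<kappa>" "Q \<in> p \<Longrightarrow> adequate \<kappa> Q"
    and "Q0 \<in> p \<Longrightarrow> Q1 \<in> p \<Longrightarrow> delta Q0 = delta Q1 \<Longrightarrow> model_iso Q0 Q1 (Psi Q0 Q1)"
    and "Q0 \<in> p \<Longrightarrow> Q1 \<in> p \<Longrightarrow> mem (delta Q0) (delta Q1) \<Longrightarrow>
      \<exists>Q1'\<in>p. delta Q1' = delta Q1 \<and> Q0 \<in> Q1'[\<omega>\<^sub>1]"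
    and "Q \<in> p \<Longrightarrow> M \<in> p \<Longrightarrow> countable (elts M) \<Longrightarrow> Q \<in> M[\<omega>\<^sub>1] \<Longrightarrow>
      \<not> (\<exists>Q'\<in>p. mem (delta Q) (delta Q') \<and> mem (delta Q') (delta M)) \<Longrightarrow> mem Q M"
    and "N \<in> p \<Longrightarrow> M \<in> p \<Longrightarrow> uncountable (elts N) \<Longrightarrow> countable (elts M) \<Longrightarrow> mem N M \<Longrightarrow>
      vset (elts N \<inter> elts M) \<in> p"
    and "Q0 \<in> p \<Longrightarrow> Q1 \<in> p \<Longrightarrow> Q1' \<in> p \<Longrightarrow> mem Q0 Q1 \<Longrightarrow> delta Q1 = delta Q1' \<Longrightarrow> Psi Q1 Q1' Q0 \<in> p"
proof -
  note d = assms[unfolded symmetric_system_def]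
  from d show "finite p" by (elim conjE)
  from d show "p \<subseteq> H \<kappa>" by (elim conjE)
  from d show "adequate \<kappa> Q" if "Q \<in> p" using that by (elim conjE) blast
  have "Q0 = Q1 \<or> (\<exists>F. model_iso Q0 Q1 F)" if "Q0 \<in> p" "Q1 \<in> p" "delta Q0 = delta Q1"
    using d that by (elim conjE) blast
  then show "model_iso Q0 Q1 (Psi Q0 Q1)" if "Q0 \<in> p" "Q1 \<in> p" "delta Q0 = delta Q1"
    using that by (intro model_iso_Psi)
  show "\<exists>Q1'\<in>p. delta Q1' = delta Q1 \<and> Q0 \<in> Q1'[\<omega>\<^sub>1]"
    if "Q0 \<in> p" "Q1 \<in> p" "mem (delta Q0) (delta Q1)"
  proof -
    have "Q0 \<noteq> Q1" using that(3) mem_irrefl by blast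
    then show ?thesis using d that by (elim conjE) blast
  qed
  show "mem Q M" if "Q \<in> p" "M \<in> p" "countable (elts M)" "Q \<in> M[\<omega>\<^sub>1]"
      "\<not> (\<exists>Q'\<in>p. mem (delta Q) (delta Q') \<and> mem (delta Q') (delta M))"
    using d that by (elim conjE) blast
  show "vset (elts N \<inter> elts M) \<in> p"
    if "N \<in> p" "M \<in> p" "uncountable (elts N)" "countable (elts M)" "mem N M"
    using d that by (elim conjE) blast
  have "\<forall>Q0\<in>p. \<forall>Q1\<in>p. \<forall>Q1'\<in>p. mem Q0 Q1 \<and> delta Q1 = delta Q1' \<longrightarrow> Psi Q1 Q1' Q0 \<in> p"
    using d by (elim conjE)
  then show "Psi Q1 Q1' Q0 \<in> p"
    if "Q0 \<in> p" "Q1 \<in> p" "Q1' \<in> p" "mem Q0 Q1" "delta Q1 = delta Q1'"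
    using that by simp
qed

text \<open>By uniqueness on \<open>Q0\<close>, the arbitrary choice in \<open>Psi\<close> may be
  replaced by any isomorphism at hand.\<close>

lemma Psi_eq:
  assumes "adequate \<kappa> Q0" "adequate \<kappa> Q1" "model_iso Q0 Q1 F" "mem x Q0"
  shows "Psi Q0 Q1 x = F x"
proof (rule model_iso_unique[of Q0 Q1 _ F])
  have Q: "elementary_submodel (elts Q0) (H \<kappa>)" "elementary_submodel (elts Q1) (H \<kappa>)"
    using assms by (auto simp: adequate_def)
  show "model_iso Q0 Q1 (Psi Q0 Q1)" using assms by (blast intro: model_iso_Psi)
  show "elts Q0 \<subseteq> Q0[\<omega>\<^sub>1]" "elts Q1 \<subseteq> Q1[\<omega>\<^sub>1]" by (fact elts_subset_hull1[OF Q(1)] elts_subset_hull1[OF Q(2)])+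
  show "y = z" if "mem y Q1" "mem z Q1" "\<And>w. mem w Q1 \<Longrightarrow> mem w y \<longleftrightarrow> mem w z" for y z
    using Q(2) that by (rule elementary_submodel_extensional)
qed (use assms in auto)

lemma system_iso_preimage:
  assumes \<Phi>: "system_iso p q \<Phi>" and Q: "Q \<in> q"
  obtains Q' where "Q' \<in> p" "\<Phi> Q' = Q" "delta Q' = delta Q"
proof -
  have "Q \<in> \<Phi> ` p" using assms by (simp add: system_iso_def)
  then obtain Q' where Q': "Q' \<in> p" "\<Phi> Q' = Q" by blast
  moreover have "delta Q' = delta Q" using \<Phi> Q' by (auto simp: system_iso_def)
  ultimately show thesis by (rule that)
qed

text \<open>A common point of the hulls of \<open>Q0\<close> and \<open>\<Phi> Q1\<close> lies in
  both supports and is fixed by \<open>\<Phi>\<close>. It therefore lies in the hull of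
  \<open>Q1\<close> too, where \<open>Psi Q0 Q1\<close> fixes it.\<close>

lemma model_iso_across:
  assumes p: "symmetric_system \<kappa> p" and \<Phi>: "system_iso p q \<Phi>"
    and Q: "Q0 \<in> p" "Q1 \<in> p" "delta Q0 = delta Q1"
  shows "model_iso Q0 (\<Phi> Q1) (\<Phi> \<circ> Psi Q0 Q1)"
proof (rule model_iso_comp)
  show iso: "model_iso Q0 Q1 (Psi Q0 Q1)" using symmetric_systemD(4)[OF p] Q by blast
  show iso': "model_iso Q1 (\<Phi> Q1) \<Phi>" using system_iso_model_iso[OF \<Phi> Q(2)] .
  fix x assume x: "x \<in> Q0[\<omega>\<^sub>1]" "x \<in> (\<Phi> Q1)[\<omega>\<^sub>1]"
  have "\<Phi> Q1 \<in> q" using \<Phi> Q unfolding system_iso_def by blast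
  then have X: "x \<in> support p" "x \<in> support q" using x Q unfolding support_def by blast+
  then have fixed: "\<Phi> x = x" using \<Phi> unfolding system_iso_def by blast
  then have "x \<in> Q1[\<omega>\<^sub>1]" using \<Phi> Q(2) x(2) X unfolding system_iso_def by metis
  then have "Psi Q0 Q1 x = x" using iso x(1) unfolding model_iso_def by blast
  with fixed show "\<Phi> (Psi Q0 Q1 x) = x" by simp
qed

lemma ex_model_iso_across:
  assumes p: "symmetric_system \<kappa> p" and \<Phi>: "system_iso p q \<Phi>"
    and Q: "Q0 \<in> p" "Q1 \<in> q" "delta Q0 = delta Q1"
  shows "\<exists>F. model_iso Q0 Q1 F"
  using system_iso_preimage[OF \<Phi> Q(2)] model_iso_across[OF p \<Phi> Q(1)] Q(3) by metis

text \<open>Clause (C) depends on \<open>Q1\<close> only through \<open>delta Q1\<close>, and the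
  preimage of \<open>Q1\<close> under \<open>\<Phi>\<close> is a model of \<open>p\<close> with the
  same value.\<close>

lemma ex_model_above_across:
  assumes p: "symmetric_system \<kappa> p" and \<Phi>: "system_iso p q \<Phi>"
    and Q: "Q0 \<in> p" "Q1 \<in> q" "mem (delta Q0) (delta Q1)"
  shows "\<exists>Q1'\<in>p. delta Q1' = delta Q1 \<and> Q0 \<in> Q1'[\<omega>\<^sub>1]"
  using system_iso_preimage[OF \<Phi> Q(2)] symmetric_systemD(5)[OF p Q(1)] Q(3) by metis

text \<open>On \<open>Q1\<close> the map \<open>Psi Q1 Q1'\<close> agrees with an isomorphism inside
  \<open>p\<close> followed by \<open>\<Phi>\<close>. Clause (F) for \<open>p\<close> handles the
  former, and \<open>\<Phi>\<close> maps \<open>p\<close> onto \<open>q\<close>.\<close>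

lemma Psi_across:
  assumes p: "symmetric_system \<kappa> p" and q: "symmetric_system \<kappa> q" and \<Phi>: "system_iso p q \<Phi>"
    and Q: "Q0 \<in> p" "Q1 \<in> p" "Q1' \<in> q" "mem Q0 Q1" "delta Q1 = delta Q1'"
  shows "Psi Q1 Q1' Q0 \<in> q"
proof -
  obtain Q2 where Q2: "Q2 \<in> p" "\<Phi> Q2 = Q1'" "delta Q2 = delta Q1'"
    using system_iso_preimage[OF \<Phi> Q(3)] .
  then have "model_iso Q1 Q1' (\<Phi> \<circ> Psi Q1 Q2)"
    using model_iso_across[OF p \<Phi> Q(2) Q2(1)] Q(5) by simp
  then have "Psi Q1 Q1' Q0 = \<Phi> (Psi Q1 Q2 Q0)"
    using Psi_eq[OF symmetric_systemD(3)[OF p Q(2)] symmetric_systemD(3)[OF q Q(3)]] Q(4) by simp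
  moreover have "Psi Q1 Q2 Q0 \<in> p"
    using symmetric_systemD(8)[OF p] Q Q2 by simp
  ultimately show ?thesis using \<Phi> unfolding system_iso_def by blast
qed

lemma symmetric_system_Un:
  assumes p: "symmetric_system \<kappa> p" and q: "symmetric_system \<kappa> q" and \<Phi>: "system_iso p q \<Phi>"
  shows "symmetric_system \<kappa> (p \<union> q)"
proof -
  note \<Psi> = system_iso_sym[OF \<Phi>]
  note shared = system_iso_shared_model[OF \<Phi>] system_iso_shared_model[OF \<Psi>]
  have in_support: "x \<in> support r" if "Q \<in> r" "x \<in> elts Q \<union> Q[\<omega>\<^sub>1]" for x Q and r :: "'k hset set"
    using that by (auto simp: support_def)
  \<comment> \<open>A model lying in another model or its hull never mixes the two conditions, so
    (D) and (E) are inherited, and in (F) only \<open>Q1'\<close> may come from the other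
    side.\<close>
  have same: "x \<in> p \<and> Q \<in> p \<or> x \<in> q \<and> Q \<in> q"
    if "x \<in> p \<union> q" "Q \<in> p \<union> q" "x \<in> elts Q \<union> Q[\<omega>\<^sub>1]" for x Q
    using that(1,2) shared[of x] in_support[OF _ that(3)] by blast
  show ?thesis
    unfolding symmetric_system_def
  proof (intro conjI ballI impI)
    show "finite (p \<union> q)" "p \<union> q \<subseteq> H \<kappa>" using symmetric_systemD(1,2)[OF p] symmetric_systemD(1,2)[OF q] by auto
    show "adequate \<kappa> Q" if "Q \<in> p \<union> q" for Q
      using that symmetric_systemD(3)[OF p] symmetric_systemD(3)[OF q] by blast
    show "\<exists>F. model_iso Q0 Q1 F"
      if "Q0 \<in> p \<union> q" "Q1 \<in> p \<union> q" "Q0 \<noteq> Q1 \<and> delta Q0 = delta Q1" for Q0 Q1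
      using that ex_model_iso_across[OF p \<Phi>, of Q0 Q1] ex_model_iso_across[OF q \<Psi>, of Q0 Q1]
        symmetric_systemD(4)[OF p, of Q0 Q1] symmetric_systemD(4)[OF q, of Q0 Q1] by blast
    show "\<exists>Q1'\<in>p \<union> q. delta Q1' = delta Q1 \<and> Q0 \<in> Q1'[\<omega>\<^sub>1]"
      if "Q0 \<in> p \<union> q" "Q1 \<in> p \<union> q" "Q0 \<noteq> Q1 \<and> mem (delta Q0) (delta Q1)" for Q0 Q1
      using that ex_model_above_across[OF p \<Phi>, of Q0 Q1] ex_model_above_across[OF q \<Psi>, of Q0 Q1]
        symmetric_systemD(5)[OF p, of Q0 Q1] symmetric_systemD(5)[OF q, of Q0 Q1] by blast
    show "mem Q M"
      if "Q \<in> p \<union> q" "M \<in> p \<union> q" and h: "countable (elts M) \<and> Q \<in> M[\<omega>\<^sub>1] \<and>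
        \<not> (\<exists>Q'\<in>p \<union> q. mem (delta Q) (delta Q') \<and> mem (delta Q') (delta M))" for Q M
    proof -
      have "Q \<in> p \<and> M \<in> p \<or> Q \<in> q \<and> M \<in> q"
        using that by (intro same) auto
      then show ?thesis
        using h symmetric_systemD(6)[OF p, of Q M] symmetric_systemD(6)[OF q, of Q M] by blast
    qed
    show "vset (elts N \<inter> elts M) \<in> p \<union> q"
      if "N \<in> p \<union> q" "M \<in> p \<union> q" and h: "uncountable (elts N) \<and> countable (elts M) \<and> mem N M" for N M
    proof -
      have "N \<in> p \<and> M \<in> p \<or> N \<in> q \<and> M \<in> q"
        using that by (intro same) auto
      then show ?thesis
        using h symmetric_systemD(7)[OF p, of N M] symmetric_systemD(7)[OF q, of N M] by blast
    qed
    show "Psi Q1 Q1' Q0 \<in> p \<union> q"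
      if "Q0 \<in> p \<union> q" "Q1 \<in> p \<union> q" "Q1' \<in> p \<union> q" and h: "mem Q0 Q1 \<and> delta Q1 = delta Q1'" for Q0 Q1 Q1'
    proof -
      have "Q0 \<in> p \<and> Q1 \<in> p \<or> Q0 \<in> q \<and> Q1 \<in> q"
        using that by (intro same) auto
      then show ?thesis
        using h \<open>Q1' \<in> p \<union> q\<close> Psi_across[OF p q \<Phi>, of Q0 Q1 Q1'] Psi_across[OF q p \<Psi>, of Q0 Q1 Q1']
          symmetric_systemD(8)[OF p, of Q0 Q1 Q1'] symmetric_systemD(8)[OF q, of Q0 Q1 Q1'] by blast
    qed
  qed
qed

section \<open>Sizes of hulls and supports, and codes for isomorphism types\<close>

lemma card_of_hull1:
  fixes Q :: "'k hset"
  assumes "|elts Q| \<le>o aleph1"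
  shows "|Q[\<omega>\<^sub>1]| \<le>o aleph1"
proof -
  have "Q[\<omega>\<^sub>1] \<subseteq> (\<lambda>(f, a). app f a) ` (elts Q \<times> elts omega1)"
    by (force simp: hull1_def)
  moreover have "|elts Q \<times> elts (omega1 :: 'k hset)| \<le>o aleph1"
    using assms ordIso_imp_ordLeq[OF omega1(2)] Cinfinite_aleph1 by (rule card_of_Times_Cinfinite_bound)
  ultimately show ?thesis by (meson card_of_image_ordLeq card_of_subset_ordLeq)
qed

lemma card_of_adequate:
  assumes "adequate \<kappa> Q"
  shows "|elts Q| \<le>o aleph1"
  using assms ordIso_imp_ordLeq ordLess_imp_ordLeq
  unfolding adequate_def countable_iff_ordLess_aleph1 by blast

lemma card_of_finite_aleph1: "finite A \<Longrightarrow> |A| \<le>o aleph1"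
  by (rule ordLess_imp_ordLeq) (simp add: countable_finite flip: countable_iff_ordLess_aleph1)

lemma card_of_support:
  assumes p: "symmetric_system \<kappa> p"
  shows "|support p| \<le>o aleph1"
  unfolding support_def
  by (intro Un_Cinfinite_bound UNION_Cinfinite_bound ballI card_of_hull1 Cinfinite_aleph1
      card_of_finite_aleph1 card_of_adequate symmetric_systemD[OF p])

end

text \<open>The structure of \<open>p\<close> transported along an enumeration \<open>e\<close> of
  its support. The last component keeps the sets \<open>delta Q\<close> themselves rather than
  indices, since isomorphic conditions must have equal values of \<open>delta\<close>.\<close>

definition system_code ::
  "('k hset \<Rightarrow> 'i) \<Rightarrow> 'k hset set \<Rightarrow> 'i set \<times> 'i set \<times> ('i \<times> 'i) set \<times> ('i \<times> 'i) set \<times> ('i \<times> 'k hset) set" where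
  "system_code e p = (e ` support p, e ` p,
     {(e x, e y) | x y. x \<in> support p \<and> y \<in> support p \<and> mem x y},
     {(e Q, e x) | Q x. Q \<in> p \<and> x \<in> Q[\<omega>\<^sub>1]},
     {(e Q, delta Q) | Q. Q \<in> p})"

lemma system_iso_of_code:
  assumes e: "inj_on e (support p)" and f: "inj_on f (support q)"
    and code: "system_code e p = system_code f q"
    and agree: "\<And>x. x \<in> support p \<Longrightarrow> x \<in> support q \<Longrightarrow> e x = f x"
  shows "system_iso p q (inv_into (support q) f \<circ> e)"
proof -
  define \<Phi> where "\<Phi> = inv_into (support q) f \<circ> e"
  have sub: "p \<subseteq> support p" "q \<subseteq> support q" by (auto simp: support_def)
  have hull_sub: "x \<in> support r" if "Q \<in> r" "x \<in> Q[\<omega>\<^sub>1]" for r :: "'a hset set" and Q x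
    using that by (auto simp: support_def)
  have im: "e ` support p = f ` support q" and im': "e ` p = f ` q"
    and E: "{(e x, e y) | x y. x \<in> support p \<and> y \<in> support p \<and> mem x y} =
        {(f x, f y) | x y. x \<in> support q \<and> y \<in> support q \<and> mem x y}"
    and Hu: "{(e Q, e x) | Q x. Q \<in> p \<and> x \<in> Q[\<omega>\<^sub>1]} = {(f Q, f x) | Q x. Q \<in> q \<and> x \<in> Q[\<omega>\<^sub>1]}"
    and D: "{(e Q, delta Q) | Q. Q \<in> p} = {(f Q, delta Q) | Q. Q \<in> q}"
    using code by (simp_all add: system_code_def)
  \<comment> \<open>\<open>\<Phi> x\<close> is the element of \<open>support q\<close> with the same
    index as \<open>x\<close>; it exists because equal codes have equal sets of indices.\<close>
  have f\<Phi>: "f (\<Phi> x) = e x" "\<Phi> x \<in> support q" if "x \<in> support p" for x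
    using that im by (auto simp: \<Phi>_def intro!: f_inv_into_f inv_into_into)
  have \<Phi>I: "\<Phi> x = y" if "x \<in> support p" "y \<in> support q" "e x = f y" for x y
    using that f by (simp add: \<Phi>_def inv_into_f_f)
  have \<Phi>p: "\<Phi> Q \<in> q" if "Q \<in> p" for Q
  proof -
    have "e Q \<in> f ` q" using that im' by auto
    then obtain Q' where "Q' \<in> q" "e Q = f Q'" by blast
    then show ?thesis using \<Phi>I[of Q Q'] sub that by auto
  qed
  have e_eq: "e x = e y \<longleftrightarrow> x = y" if "x \<in> support p" "y \<in> support p" for x y
    using e that by (auto dest: inj_onD)
  have f_eq: "f x = f y \<longleftrightarrow> x = y" if "x \<in> support q" "y \<in> support q" for x y
    using f that by (auto dest: inj_onD)
  show ?thesis
    unfolding \<Phi>_def[symmetric] system_iso_def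
  proof (intro conjI ballI)
    show "bij_betw \<Phi> (support p) (support q)"
      unfolding \<Phi>_def using e f im
      by (intro bij_betw_trans[of e _ "e ` support p"]) (auto simp: bij_betw_def inj_on_inv_into)
    show "\<Phi> ` p = q"
    proof
      show "q \<subseteq> \<Phi> ` p"
      proof
        fix Q assume Q: "Q \<in> q"
        then have "f Q \<in> e ` p" using im' by auto
        then obtain Q' where "Q' \<in> p" "e Q' = f Q" by force
        moreover from this have "\<Phi> Q' = Q" using sub Q by (intro \<Phi>I) auto
        ultimately show "Q \<in> \<Phi> ` p" by blast
      qed
    qed (use \<Phi>p in blast)
    show "mem x y \<longleftrightarrow> mem (\<Phi> x) (\<Phi> y)" if xy: "x \<in> support p" "y \<in> support p" for x y
    proof -
      have "mem x y \<longleftrightarrow> (e x, e y) \<in> {(e x, e y) | x y. x \<in> support p \<and> y \<in> support p \<and> mem x y}"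
        using xy e_eq by auto
      also have "\<dots> \<longleftrightarrow> (f (\<Phi> x), f (\<Phi> y)) \<in> {(f x, f y) | x y. x \<in> support q \<and> y \<in> support q \<and> mem x y}"
        unfolding E f\<Phi>(1)[OF xy(1)] f\<Phi>(1)[OF xy(2)] ..
      also have "\<dots> \<longleftrightarrow> mem (\<Phi> x) (\<Phi> y)"
        using f\<Phi>(2)[OF xy(1)] f\<Phi>(2)[OF xy(2)] f_eq by auto
      finally show ?thesis .
    qed
    show "x \<in> Q[\<omega>\<^sub>1] \<longleftrightarrow> \<Phi> x \<in> (\<Phi> Q)[\<omega>\<^sub>1]" if xy: "Q \<in> p" "x \<in> support p" for Q x
    proof -
      have Q: "Q \<in> support p" using sub xy by blast
      have "x \<in> Q[\<omega>\<^sub>1] \<longleftrightarrow> (e Q, e x) \<in> {(e Q, e x) | Q x. Q \<in> p \<and> x \<in> Q[\<omega>\<^sub>1]}"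
        using xy Q e_eq sub(1) hull_sub[of _ p] by (auto simp: subset_iff)
      also have "\<dots> \<longleftrightarrow> (f (\<Phi> Q), f (\<Phi> x)) \<in> {(f Q, f x) | Q x. Q \<in> q \<and> x \<in> Q[\<omega>\<^sub>1]}"
        unfolding Hu f\<Phi>(1)[OF xy(2)] f\<Phi>(1)[OF Q] ..
      also have "\<dots> \<longleftrightarrow> \<Phi> x \<in> (\<Phi> Q)[\<omega>\<^sub>1]"
        using f\<Phi>(2)[OF Q] f\<Phi>(2)[OF xy(2)] \<Phi>p[OF xy(1)] f_eq sub(2) hull_sub[of _ q]
        by (auto simp: subset_iff)
      finally show ?thesis .
    qed
    show "delta (\<Phi> Q) = delta Q" if Q: "Q \<in> p" for Q
    proof -
      have "(e Q, delta Q) \<in> {(f Q, delta Q) | Q. Q \<in> q}" unfolding D[symmetric] using Q by blast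
      then obtain Q' where "Q' \<in> q" "e Q = f Q'" "delta Q = delta Q'" by blast
      moreover from this have "\<Phi> Q = Q'" using Q sub by (intro \<Phi>I) auto
      ultimately show ?thesis by simp
    qed
    show "\<Phi> x = x" if "x \<in> support p \<inter> support q" for x
      using that by (intro \<Phi>I agree) auto
  qed
qed

theorem mainTheorem3:
  fixes \<kappa> :: "'k rel"
  assumes "ctwo ^c aleph1 =o aleph2"
    and "Card_order \<kappa>" and "regularCard \<kappa>" and "aleph2 <o \<kappa>"
  shows "chain_condition aleph3 {\<N>. symmetric_system \<kappa> \<N>} (\<lambda>q p. p \<subseteq> q)"
  unfolding chain_condition_def
proof (intro allI impI)
  fix A :: "'k hset set set"
  assume anti: "forcing_antichain {\<N>. symmetric_system \<kappa> \<N>} (\<lambda>q p. p \<subseteq> q) A"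
  interpret large_regular \<kappa> by unfold_locales fact+
  let ?I = "Field aleph1"
  have A: "symmetric_system \<kappa> p" if "p \<in> A" for p
    using anti that by (auto simp: forcing_antichain_def)
  \<comment> \<open>The cardinal arithmetic hypothesis enters here, through
    \<open>(ctwo ^c aleph1) ^c aleph1 =o ctwo ^c aleph1\<close>.\<close>
  have exp: "aleph2 ^c aleph1 \<le>o aleph2"
  proof -
    have "aleph2 ^c aleph1 \<le>o (ctwo ^c aleph1) ^c aleph1"
      using Cinfinite_aleph1 by (intro cexp_mono1 ordIso_imp_ordLeq[OF ordIso_symmetric[OF assms(1)]]) simp
    also have "(ctwo ^c aleph1) ^c aleph1 =o ctwo ^c aleph1"
      using Cinfinite_aleph1 Cinfinite_Cnotzero
      by (intro cexp_cprod_ordLeq Card_order_ctwo) (auto intro: ordLeq_refl)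
    also note assms(1)
    finally show ?thesis .
  qed
  have I1: "|?I| \<le>o aleph1"
    using Cinfinite_aleph1 by (intro ordIso_imp_ordLeq card_of_Field_ordIso) simp
  have I2: "|?I| \<le>o aleph2"
    by (rule ordLeq_transitive[OF I1 ordLess_imp_ordLeq[OF aleph1_ordLess_aleph2]])
  have "\<exists>e. inj_on e (support p) \<and> e ` support p \<subseteq> ?I" if "p \<in> A" for p
  proof -
    have "|support p| \<le>o |?I|"
      using Cinfinite_aleph1
      by (intro ordLeq_ordIso_trans[OF card_of_support[OF A[OF that]] ordIso_symmetric[OF card_of_Field_ordIso]]) simp
    then show ?thesis unfolding card_of_ordLeq .
  qed
  then obtain e where e: "\<And>p. p \<in> A \<Longrightarrow> inj_on (e p) (support p)"
    "\<And>p. p \<in> A \<Longrightarrow> e p ` support p \<subseteq> ?I" by metis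
  \<comment> \<open>The graph of the enumeration with the index first, so that \<open>snd\<close>
    recovers the support.\<close>
  define \<Gamma> where "\<Gamma> p = (\<lambda>x. (e p x, x)) ` support p" for p
  define c where "c p = system_code (e p) p" for p
  \<comment> \<open>Each of the five components is a subset of size at most \<open>aleph1\<close> of
    a set of size at most \<open>aleph2\<close>; by \<open>exp\<close> there are at most
    \<open>aleph2\<close> such subsets.\<close>
  have code_card: "|c ` A| \<le>o aleph2"
  proof -
    let ?B = "\<lambda>S. {B. B \<subseteq> S \<and> |B| \<le>o aleph1}"
    let ?D = "insert omega2 (elts omega2) :: 'k hset set"
    have B: "|?B S| \<le>o aleph2" if "|S| \<le>o aleph2" for S :: "'s set"
      by (rule card_of_bounded_subsets[OF Cinfinite_aleph1 Cinfinite_aleph2 exp that])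
    have "|{omega2 :: 'k hset} \<union> elts omega2| \<le>o aleph2"
      by (intro Un_Cinfinite_bound Cinfinite_aleph2 ordIso_imp_ordLeq[OF omega2(2)]
          ordLeq_transitive[OF card_of_finite_aleph1 ordLess_imp_ordLeq[OF aleph1_ordLess_aleph2]]) simp
    then have D: "|?D| \<le>o aleph2" by simp
    have "c p \<in> ?B ?I \<times> ?B ?I \<times> ?B (?I \<times> ?I) \<times> ?B (?I \<times> ?I) \<times> ?B (?I \<times> ?D)" if p: "p \<in> A" for p
    proof -
      have II: "|S| \<le>o aleph1" if "S \<subseteq> ?I \<times> ?I" for S
        using card_of_subset_ordLeq[OF that card_of_Times_Cinfinite_bound[OF I1 I1 Cinfinite_aleph1]] .
      have E: "e p x \<in> ?I" if "x \<in> support p" for x using e(2)[OF p] that by blast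
      have sub: "p \<subseteq> support p" "\<And>Q x. Q \<in> p \<Longrightarrow> x \<in> Q[\<omega>\<^sub>1] \<Longrightarrow> x \<in> support p"
        by (auto simp: support_def)
      have dl: "{(e p Q, delta Q) | Q. Q \<in> p} = (\<lambda>Q. (e p Q, delta Q)) ` p" by blast
      have "|{(e p Q, delta Q) | Q. Q \<in> p}| \<le>o aleph1"
        unfolding dl using symmetric_systemD(1)[OF A[OF p]] by (intro card_of_finite_aleph1) simp
      moreover have "{(e p Q, delta Q) | Q. Q \<in> p} \<subseteq> ?I \<times> ?D"
        using E sub(1) delta_cases by blast
      moreover have "e p ` support p \<subseteq> ?I" "e p ` p \<subseteq> ?I" using E sub by auto
      moreover have "{(e p x, e p y) | x y. x \<in> support p \<and> y \<in> support p \<and> mem x y} \<subseteq> ?I \<times> ?I"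
        "{(e p Q, e p x) | Q x. Q \<in> p \<and> x \<in> Q[\<omega>\<^sub>1]} \<subseteq> ?I \<times> ?I"
        using E sub by blast+
      ultimately show ?thesis
        unfolding c_def system_code_def using II I1 card_of_subset_ordLeq by (simp add: card_of_subset_ordLeq[OF _ I1])
    qed
    then have "c ` A \<subseteq> ?B ?I \<times> ?B ?I \<times> ?B (?I \<times> ?I) \<times> ?B (?I \<times> ?I) \<times> ?B (?I \<times> ?D)" by blast
    moreover have "|?B ?I \<times> ?B ?I \<times> ?B (?I \<times> ?I) \<times> ?B (?I \<times> ?I) \<times> ?B (?I \<times> ?D)| \<le>o aleph2"
      by (intro card_of_Times_Cinfinite_bound B I2 D Cinfinite_aleph2)
    ultimately show ?thesis by (rule card_of_subset_ordLeq)
  qed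
  show "|A| <o aleph3"
  proof (rule ccontr)
    assume "\<not> |A| <o aleph3"
    then have "\<not> |A| \<le>o aleph2"
      using cardSuc_ordLeq_ordLess[of aleph2 "|A|"] Cinfinite_aleph2 card_of_Card_order by blast
    then have "\<exists>p\<in>A. \<exists>q\<in>A. p \<noteq> q \<and> c p = c q \<and> (\<forall>(i, x)\<in>\<Gamma> p. x \<in> snd ` \<Gamma> q \<longrightarrow> (i, x) \<in> \<Gamma> q)"
    proof (intro ex_agreeing_pair[OF Cinfinite_aleph1 exp _ _ I2 code_card])
      fix p assume p: "p \<in> A"
      show "|\<Gamma> p| \<le>o aleph1" unfolding \<Gamma>_def by (intro card_of_image_ordLeq card_of_support A p)
      show "fst ` \<Gamma> p \<subseteq> ?I" using e(2)[OF p] by (auto simp: \<Gamma>_def)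
    qed
    then obtain p q where pq: "p \<in> A" "q \<in> A" "p \<noteq> q" "c p = c q"
      and agree: "\<And>i x. (i, x) \<in> \<Gamma> p \<Longrightarrow> x \<in> snd ` \<Gamma> q \<Longrightarrow> (i, x) \<in> \<Gamma> q" by blast
    \<comment> \<open>The only pair in \<open>\<Gamma> q\<close> with second component
      \<open>x\<close> is \<open>(e q x, x)\<close>.\<close>
    have "e p x = e q x" if "x \<in> support p" "x \<in> support q" for x
      using agree[of "e p x" x] that by (auto simp: \<Gamma>_def image_iff)
    then have "system_iso p q (inv_into (support q) (e q) \<circ> e p)"
      using pq e(1) by (intro system_iso_of_code) (auto simp: c_def)
    then have "symmetric_system \<kappa> (p \<union> q)"
      using A pq by (intro symmetric_system_Un) auto
    then have "compatible {\<N>. symmetric_system \<kappa> \<N>} (\<lambda>q p. p \<subseteq> q) p q"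
      unfolding compatible_def by (intro bexI[of _ "p \<union> q"]) auto
    then show False using anti pq unfolding forcing_antichain_def by blast
  qed
qed

end
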